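(* Let $m$ be a positive integer and $E_m=\{z\in\mathbb{C}:z^m\in[-2,2]\}$. Then $$\lim_{n\to\infty}\mathcal{W}_{n,2}(E_m)^2=2.$$ Moreover, for an integer $l$, the sequence $n\mapsto\mathcal{W}_{2nm+l,2}(E_m)^2$ ($n=0,1,2,\dots$) is monotonically increasing if $0<l/m<1$ and monotonically decreasing if $1<l/m<2$.
   Context: For a compact set $E\subset\mathbb{C}$ with $\operatorname{Cap}(E)>0$ (logarithmic capacity), $\mu_E$ denotes the equilibrium measure of $E$ (the probability measure on $E$ of minimal logarithmic energy). $P_n^{\mu_E}$ denotes the monic orthogonal polynomial of degree $n$ with respect to $\mu_E$, i.e. $\int P_n^{\mu_E}\overline{P_k^{\mu_E}}\,d\mu_E=0$ for $n\ne k$; equivalently, the monic polynomial of degree $n$ of minimal norm in $L^2(\mu_E)$. The $L^2$ Widom factors are $\mathcal{W}_{n,2}(E)=\|P_n^{\mu_E}\|_{L^2(\mu_E)}/\operatorname{Cap}(E)^n$. *)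

theory Defs
  imports "HOL-Probability.Probability" "HOL-Computational_Algebra.Polynomial"
begin

definition prob_measures_on :: "complex set \<Rightarrow> complex measure set" where
  "prob_measures_on E = {\<mu>. prob_space \<mu> \<and> sets \<mu> = sets borel \<and> (AE z in \<mu>. z \<in> E)}"

text \<open>The kernel \<open>log (1 / |z - w|)\<close>. The diagonal is treated separately because
  \<^term>\<open>ln 0 = (0::real)\<close> in HOL.\<close>

definition log_kernel :: "complex \<Rightarrow> complex \<Rightarrow> ereal" where
  "log_kernel z w = (if z = w then \<infinity> else ereal (ln (1 / dist z w)))"

text \<open>The double integral of the kernel, as the integral of its positive part minus the integral
  of its negative part (\<^const>\<open>e2ennreal\<close> sends negative values to \<open>0\<close>). If \<open>\<mu>\<close> is a
  probability measure on a compact set, then the subtrahend is finite, so that the energy is a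
  well-defined element of \<open>(-\<infinity>, \<infinity>]\<close>.\<close>

definition log_energy :: "complex measure \<Rightarrow> ereal" where
  "log_energy \<mu> =
     enn2ereal (\<integral>\<^sup>+ z. (\<integral>\<^sup>+ w. e2ennreal (log_kernel z w) \<partial>\<mu>) \<partial>\<mu>)
   - enn2ereal (\<integral>\<^sup>+ z. (\<integral>\<^sup>+ w. e2ennreal (- log_kernel z w) \<partial>\<mu>) \<partial>\<mu>)"

definition min_log_energy :: "complex set \<Rightarrow> ereal" where
  "min_log_energy E = (INF \<mu>\<in>prob_measures_on E. log_energy \<mu>)"

definition log_capacity :: "complex set \<Rightarrow> real" where
  "log_capacity E =
     (if min_log_energy E = \<infinity> then 0 else exp (- real_of_ereal (min_log_energy E)))"

definition is_equilibrium_measure :: "complex set \<Rightarrow> complex measure \<Rightarrow> bool" where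
  "is_equilibrium_measure E \<mu> \<longleftrightarrow>
     \<mu> \<in> prob_measures_on E \<and> (\<forall>\<nu>\<in>prob_measures_on E. log_energy \<mu> \<le> log_energy \<nu>)"

text \<open>For compact \<open>E\<close> of positive capacity there is exactly one such measure.\<close>

definition equilibrium_measure :: "complex set \<Rightarrow> complex measure" where
  "equilibrium_measure E = (THE \<mu>. is_equilibrium_measure E \<mu>)"

definition is_monic_orthogonal_seq :: "complex measure \<Rightarrow> (nat \<Rightarrow> complex poly) \<Rightarrow> bool" where
  "is_monic_orthogonal_seq \<mu> P \<longleftrightarrow>
     (\<forall>n. degree (P n) = n \<and> lead_coeff (P n) = 1) \<and>
     (\<forall>n k. n \<noteq> k \<longrightarrow> (LINT z|\<mu>. poly (P n) z * cnj (poly (P k) z)) = 0)"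

text \<open>Unique whenever \<open>\<mu>\<close> is a finite measure with infinite compact support; in particular for
  equilibrium measures of compact sets of positive capacity.\<close>

definition monic_orthogonal_poly :: "complex measure \<Rightarrow> nat \<Rightarrow> complex poly" where
  "monic_orthogonal_poly \<mu> = (THE P. is_monic_orthogonal_seq \<mu> P)"

definition L2_norm_poly :: "complex measure \<Rightarrow> complex poly \<Rightarrow> real" where
  "L2_norm_poly \<mu> p = sqrt (LINT z|\<mu>. (cmod (poly p z))\<^sup>2)"

definition widom_factor_L2 :: "nat \<Rightarrow> complex set \<Rightarrow> real" where
  "widom_factor_L2 n E =
     L2_norm_poly (equilibrium_measure E) (monic_orthogonal_poly (equilibrium_measure E) n)
       / log_capacity E ^ n"

definition star_set :: "nat \<Rightarrow> complex set" where
  "star_set m = {z. z ^ m \<in> complex_of_real ` {-2..2}}"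

end

theory Submission
  imports Defs
begin

text \<open>With \<open>A(z) = 1 + |z|\<^sup>2\<close> and \<open>\<kappa>(z, w) = |1 + z cnj w|\<^sup>2 / (A(z) A(w)) \<in> [0, 1]\<close> one has
  \<open>|z - w|\<^sup>2 = A(z) A(w) (1 - \<kappa>(z, w))\<close>, hence
  \<open>- 2 ln |z - w| = - ln A(z) - ln A(w) + \<Sum>k\<ge>1. \<kappa>(z, w)^k / k\<close>,
  a series of nonnegative and positive definite kernels of finite rank. So the logarithmic
  energy is strictly convex: a measure on a compact set whose potential is constant on the set is
  the unique minimizer, because equality forces equal integrals of all functions
  \<open>z^i cnj z^j / A(z)^k\<close> with \<open>i, j \<le> k\<close>, which span an algebra dense by Stone-Weierstrass.

  On the star, put \<open>z^(2m) = 4 sin\<^sup>2 \<phi>\<close> with \<open>\<phi>\<close> uniform. The potential vanishes because the product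
  of \<open>|z - w|\<close> over the \<open>2m\<close> points \<open>w\<close> with the same \<open>\<phi>\<close> is
  \<open>4 |sin\<^sup>2 \<theta> - sin\<^sup>2 \<phi>| = |2 sin (\<theta> + \<phi>)| |2 sin (\<theta> - \<phi>)|\<close> and \<open>ln |2 sin|\<close> has mean zero. The orthogonal
  polynomial of degree \<open>2mn + l\<close> is \<open>z^l R(z^(2m))\<close> with a Jacobi polynomial \<open>R\<close>, whose coefficients
  are explicit. With \<open>s = l/m\<close> its squared norm is
  \<open>2 \<Gamma>(2n + 1) \<Gamma>(2n + 2s) / (\<Gamma>(2n + s) \<Gamma>(2n + s + 1))\<close>, from which the limit and, via the quotient of
  consecutive terms, the monotonicity are read off.\<close>

section \<open>The logarithmic kernel in chordal form\<close>

text \<open>The equilibrium measure and the orthogonal polynomials are both defined by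
  \<open>THE\<close>, so uniqueness has to be proved for each. For the measure the obstacle is that
  the logarithmic kernel changes sign and is in general positive definite only on signed measures of
  total mass zero. Passing to the chordal distance costs only the terms \<open>ln (wt z)\<close>,
  which depend on one variable and are bounded on a bounded set. In return every summand of the
  kernel is nonnegative, sums and integrals are exchanged inside \<open>ennreal\<close>, and
  competitors of infinite energy fit in without a theory of their own. The diagonal takes care of
  itself: there the series is the harmonic one, and its divergence matches the value \<infinity> of
  \<open>log_kernel\<close>. The map z |-> z^(2m) sends the star onto [0, 4], an interval of
  capacity 1. This is why the potential of the star is 0 rather than another constant, and why its
  Widom factors are bare norms.\<close>

definition wt :: "complex \<Rightarrow> real" where
  "wt z = 1 + (cmod z)\<^sup>2"

text \<open>The squared cosine of the angle between the vectors (1, z) and (1, w) of C^2; the bound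
  by 1 is Cauchy-Schwarz.\<close>

definition kap :: "complex \<Rightarrow> complex \<Rightarrow> real" where
  "kap z w = (cmod (1 + z * cnj w))\<^sup>2 / (wt z * wt w)"

text \<open>The building blocks of \<open>kap z w ^ k\<close>. For i, j <= k they are bounded by 1
  on the whole plane, because |z| and 1 are both at most sqrt (wt z); hence they are integrable for
  every Borel probability measure.\<close>

definition chordal_mono :: "nat \<Rightarrow> nat \<Rightarrow> nat \<Rightarrow> complex \<Rightarrow> complex" where
  "chordal_mono k i j z = z ^ i * cnj z ^ j / of_real (wt z ^ k)"

text \<open>The term \<open>k = 0\<close> vanishes because \<open>x / 0 = 0\<close>.\<close>

definition chordal_log :: "complex \<Rightarrow> complex \<Rightarrow> ennreal" where
  "chordal_log z w = (\<Sum>k. ennreal (kap z w ^ k / real k))"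

lemma wt_ge_1: "wt z \<ge> 1"
  by (simp add: wt_def)

lemma wt_pos: "wt z > 0"
  using wt_ge_1[of z] by linarith

lemma wt_nonzero: "wt z \<noteq> 0"
  using wt_pos[of z] by simp

lemma of_real_wt: "of_real (wt z) = 1 + z * cnj z"
  by (simp add: wt_def complex_norm_square del: of_real_power)

text \<open>Lagrange's identity \<open>|1 + z cnj w|\<^sup>2 + |z - w|\<^sup>2 = (1 + |z|\<^sup>2) (1 + |w|\<^sup>2)\<close>:
  \<open>1 - kap z w\<close> is the squared chordal distance on the Riemann sphere.\<close>

lemma one_minus_kap: "1 - kap z w = (dist z w)\<^sup>2 / (wt z * wt w)"
proof -
  have "complex_of_real ((cmod (1 + z * cnj w))\<^sup>2 + (dist z w)\<^sup>2) = of_real (wt z * wt w)"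
    unfolding of_real_add complex_norm_square dist_norm of_real_mult of_real_wt
    by (simp add: algebra_simps)
  then have "(cmod (1 + z * cnj w))\<^sup>2 + (dist z w)\<^sup>2 = wt z * wt w"
    by (simp only: of_real_eq_iff)
  then show ?thesis
    using wt_nonzero by (simp add: kap_def field_simps)
qed

lemma kap_nonneg: "0 \<le> kap z w"
  using wt_pos[of z] wt_pos[of w] by (simp add: kap_def)

lemma kap_le_1: "kap z w \<le> 1"
proof -
  have "1 - kap z w \<ge> 0"
    unfolding one_minus_kap using wt_pos[of z] wt_pos[of w] by simp
  then show ?thesis by simp
qed

lemma kap_less_1:
  assumes "z \<noteq> w"
  shows "kap z w < 1"
proof -
  have "1 - kap z w > 0"
    unfolding one_minus_kap using wt_pos[of z] wt_pos[of w] assms by simp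
  then show ?thesis by simp
qed

lemma minus_ln_one_minus_kap:
  assumes "z \<noteq> w"
  shows "- ln (1 - kap z w) = 2 * ln (1 / dist z w) + (ln (wt z) + ln (wt w))"
  unfolding one_minus_kap using assms wt_pos[of z] wt_pos[of w]
  by (simp add: ln_div ln_mult ln_realpow)

lemma chordal_log_value_nonneg:
  assumes "z \<noteq> w"
  shows "0 \<le> 2 * ln (1 / dist z w) + (ln (wt z) + ln (wt w))"
  unfolding minus_ln_one_minus_kap[OF assms, symmetric]
  using kap_less_1[OF assms] kap_nonneg[of z w] by simp

lemma chordal_log_neq:
  assumes "z \<noteq> w"
  shows "chordal_log z w = ennreal (2 * ln (1 / dist z w) + (ln (wt z) + ln (wt w)))"
proof -
  have "(\<lambda>k. - (kap z w ^ k) / real k) sums ln (1 - kap z w)"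
    using ln_series'[of "- kap z w"] kap_less_1[OF assms] kap_nonneg[of z w] by simp
  then have "(\<lambda>k. kap z w ^ k / real k) sums (- ln (1 - kap z w))"
    using sums_minus by fastforce
  then show ?thesis
    unfolding chordal_log_def minus_ln_one_minus_kap[OF assms]
    using kap_nonneg by (intro suminf_ennreal_eq) auto
qed

lemma chordal_log_refl: "chordal_log z z = top"
proof (rule ccontr)
  assume "chordal_log z z \<noteq> top"
  moreover have "kap z z = 1"
    using one_minus_kap[of z z] by simp
  ultimately have "(\<Sum>k. ennreal (1 / real k)) \<noteq> top"
    by (simp add: chordal_log_def)
  then have "summable (\<lambda>k. 1 / real k)"
    by (intro summable_suminf_not_top) auto
  then show False
    using not_summable_harmonic[where 'a=real] by (simp add: inverse_eq_divide)
qed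

text \<open>Arranged so that no subtraction of extended nonnegative reals occurs.\<close>

lemma log_kernel_split:
  "2 * e2ennreal (log_kernel z w) + ennreal (ln (wt z) + ln (wt w))
     = chordal_log z w + 2 * e2ennreal (- log_kernel z w)"
proof (cases "z = w")
  case True
  then show ?thesis
    by (simp add: chordal_log_refl log_kernel_def e2ennreal_neg ennreal_mult_top)
next
  case False
  define x where "x = ln (1 / dist z w)"
  define c where "c = ln (wt z) + ln (wt w)"
  have c: "c \<ge> 0"
    using wt_ge_1[of z] wt_ge_1[of w] by (simp add: c_def)
  have xc: "2 * x + c \<ge> 0"
    unfolding x_def c_def by (rule chordal_log_value_nonneg[OF False])
  have k: "log_kernel z w = ereal x"
    using False by (simp add: log_kernel_def x_def)
  have mm: "e2ennreal (- ereal x) = ennreal (- x)"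
    by simp
  have two: "2 * ennreal y = ennreal (2 * y)" for y
    by (metis ennreal_mult' ennreal_numeral zero_le_numeral)
  show ?thesis
    unfolding k chordal_log_neq[OF False] x_def[symmetric] c_def[symmetric] mm e2ennreal_ereal two
    by (cases "x \<ge> 0") (use c xc in \<open>auto simp: ennreal_neg simp flip: ennreal_plus\<close>)
qed

text \<open>Expanding both factors of |1 + z cnj w|^(2k) binomially leaves nonnegative coefficients
  times products f(z) cnj (f(w)), so positive definiteness can be read off term by term.\<close>

lemma kap_power_expansion:
  "of_real (kap z w ^ k) =
     (\<Sum>i\<le>k. \<Sum>j\<le>k. of_nat (k choose i) * of_nat (k choose j)
        * (chordal_mono k i j z * cnj (chordal_mono k i j w)))"
proof -
  have "complex_of_real (kap z w ^ k) =
      (z * cnj w + 1) ^ k * (cnj z * w + 1) ^ k / of_real (wt z ^ k * wt w ^ k)"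
    unfolding kap_def of_real_power[of _ k] of_real_divide complex_norm_square power_divide
    by (simp add: power_mult_distrib add.commute mult.commute)
  also have "(z * cnj w + 1) ^ k * (cnj z * w + 1) ^ k
      = (\<Sum>i\<le>k. \<Sum>j\<le>k. (of_nat (k choose i) * (z * cnj w) ^ i) * (of_nat (k choose j) * (cnj z * w) ^ j))"
    unfolding binomial_ring by (simp add: sum_product)
  also have "\<dots> / of_real (wt z ^ k * wt w ^ k) = (\<Sum>i\<le>k. \<Sum>j\<le>k. of_nat (k choose i) * of_nat (k choose j)
        * (chordal_mono k i j z * cnj (chordal_mono k i j w)))"
    unfolding sum_divide_distrib chordal_mono_def
    by (intro sum.cong refl) (simp add: power_mult_distrib)
  finally show ?thesis .
qed

lemma borel_measurable_cnj [measurable]: "cnj \<in> borel_measurable borel"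
  by (intro borel_measurable_continuous_onI continuous_intros)

lemma borel_measurable_wt [measurable]: "wt \<in> borel_measurable borel"
  unfolding wt_def[abs_def] by measurable

lemma borel_measurable_chordal_mono [measurable]: "chordal_mono k i j \<in> borel_measurable borel"
  unfolding chordal_mono_def[abs_def] by measurable

lemma borel_measurable_kap [measurable]:
  "(\<lambda>p. kap (fst p) (snd p)) \<in> borel_measurable (borel \<Otimes>\<^sub>M borel)"
  unfolding kap_def[abs_def] by measurable

lemma borel_measurable_chordal_log [measurable]:
  "(\<lambda>p. chordal_log (fst p) (snd p)) \<in> borel_measurable (borel \<Otimes>\<^sub>M borel)"
  unfolding chordal_log_def[abs_def] by measurable

lemma borel_measurable_log_kernel [measurable]:
  "(\<lambda>p. log_kernel (fst p) (snd p)) \<in> borel_measurable (borel \<Otimes>\<^sub>M borel)"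
  unfolding log_kernel_def[abs_def] by measurable

lemma continuous_wt [continuous_intros]: "continuous_on S wt"
  unfolding wt_def[abs_def] by (intro continuous_intros)

lemma continuous_chordal_mono: "continuous_on S (chordal_mono k i j)"
  unfolding chordal_mono_def[abs_def] using wt_nonzero by (intro continuous_intros) auto

definition chordal_moment :: "complex measure \<Rightarrow> nat \<Rightarrow> nat \<Rightarrow> nat \<Rightarrow> complex" where
  "chordal_moment \<nu> k i j = (LINT z|\<nu>. chordal_mono k i j z)"

definition chordal_energy :: "nat \<Rightarrow> complex measure \<Rightarrow> complex measure \<Rightarrow> real" where
  "chordal_energy k \<nu> \<mu> = (LINT z|\<nu>. LINT w|\<mu>. kap z w ^ k)"

lemma norm_chordal_mono_le_1:
  assumes "i \<le> k" "j \<le> k"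
  shows "cmod (chordal_mono k i j z) \<le> 1"
proof -
  have s1: "sqrt (wt z) \<ge> 1" using wt_ge_1[of z] by simp
  have zs: "cmod z \<le> sqrt (wt z)"
    by (intro real_le_rsqrt) (simp add: wt_def)
  have *: "cmod z ^ i \<le> sqrt (wt z) ^ k" if "i \<le> k" for i
  proof -
    have "cmod z ^ i \<le> sqrt (wt z) ^ i" using zs by (intro power_mono) auto
    also have "\<dots> \<le> sqrt (wt z) ^ k" using s1 that by (intro power_increasing) auto
    finally show ?thesis .
  qed
  have "cmod z ^ i * cmod z ^ j \<le> sqrt (wt z) ^ k * sqrt (wt z) ^ k"
    using assms wt_pos[of z] by (intro mult_mono *) auto
  also have "\<dots> = wt z ^ k"
    using wt_pos[of z] by (simp flip: power_mult_distrib)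
  finally show ?thesis
    using wt_pos[of z] by (simp add: chordal_mono_def norm_mult norm_divide norm_power)
qed

context
  fixes \<nu> :: "complex measure"
  assumes prob: "prob_space \<nu>" and sets_eq [measurable_cong]: "sets \<nu> = sets borel"
begin

interpretation prob_space \<nu> by (fact prob)

lemma integrable_chordal_mono:
  assumes "i \<le> k" "j \<le> k"
  shows "integrable \<nu> (chordal_mono k i j)"
  using norm_chordal_mono_le_1[OF assms]
  by (intro integrable_const_bound[where B = 1]) auto

lemma integrable_kap_power: "integrable \<nu> (\<lambda>w. kap z w ^ k)"
proof (intro integrable_const_bound[where B = 1] AE_I2)
  show "norm (kap z w ^ k) \<le> 1" for w
    using kap_nonneg[of z w] kap_le_1[of z w] by (simp add: power_le_one)
  have "(\<lambda>w. kap (fst (z, w)) (snd (z, w)) ^ k) \<in> borel_measurable \<nu>"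
    by measurable
  then show "(\<lambda>w. kap z w ^ k) \<in> borel_measurable \<nu>" by simp
qed

lemma integral_kap_power:
  "complex_of_real (LINT w|\<nu>. kap z w ^ k) =
     (\<Sum>i\<le>k. \<Sum>j\<le>k. of_nat (k choose i) * of_nat (k choose j)
        * (chordal_mono k i j z * cnj (chordal_moment \<nu> k i j)))"
proof -
  have "complex_of_real (LINT w|\<nu>. kap z w ^ k) = (LINT w|\<nu>. (\<Sum>i\<le>k. \<Sum>j\<le>k. of_nat (k choose i) * of_nat (k choose j)
        * (chordal_mono k i j z * cnj (chordal_mono k i j w))))"
    by (subst integral_complex_of_real[symmetric], subst kap_power_expansion) simp
  also have "\<dots> = (\<Sum>i\<le>k. \<Sum>j\<le>k. of_nat (k choose i) * of_nat (k choose j)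
        * (chordal_mono k i j z * cnj (chordal_moment \<nu> k i j)))"
    unfolding chordal_moment_def
    by (subst Bochner_Integration.integral_sum, (intro Bochner_Integration.integrable_sum integrable_mult_right integrable_cnj integrable_chordal_mono; simp; fail),
        subst Bochner_Integration.integral_sum, (intro Bochner_Integration.integrable_sum integrable_mult_right integrable_cnj integrable_chordal_mono; simp; fail)) simp
  finally show ?thesis .
qed

lemma integral_kap_power_measurable:
  "(\<lambda>z. LINT w|\<nu>. kap z w ^ k) \<in> borel_measurable borel"
proof -
  have "(\<lambda>p. kap (fst p) (snd p) ^ k) \<in> borel_measurable (borel \<Otimes>\<^sub>M \<nu>)"
    by measurable
  then show ?thesis
    by (intro borel_measurable_lebesgue_integral) (simp add: case_prod_beta)
qed

lemma integral_kap_power_bounds: "0 \<le> (LINT w|\<nu>. kap z w ^ k)" "(LINT w|\<nu>. kap z w ^ k) \<le> 1"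
proof -
  show "0 \<le> (LINT w|\<nu>. kap z w ^ k)"
    by (simp add: kap_nonneg)
  show "(LINT w|\<nu>. kap z w ^ k) \<le> 1"
    using kap_nonneg kap_le_1
    by (intro integral_le_const integrable_kap_power AE_I2 power_le_one)
qed

end

context
  fixes \<nu> \<mu> :: "complex measure"
  assumes prob: "prob_space \<nu>" "prob_space \<mu>"
    and sets_eq [measurable_cong]: "sets \<nu> = sets borel" "sets \<mu> = sets borel"
begin

interpretation N: prob_space \<nu> by (fact prob)
interpretation M: prob_space \<mu> by (fact prob)

lemma integrable_integral_kap_power: "integrable \<nu> (\<lambda>z. LINT w|\<mu>. kap z w ^ k)"
proof (intro N.integrable_const_bound[where B = 1] AE_I2)
  show "norm (LINT w|\<mu>. kap z w ^ k) \<le> 1" for z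
    using integral_kap_power_bounds[OF prob(2) sets_eq(2)] by simp
  show "(\<lambda>z. LINT w|\<mu>. kap z w ^ k) \<in> borel_measurable \<nu>"
    using integral_kap_power_measurable[OF prob(2) sets_eq(2)]
    by (simp add: measurable_cong_sets[OF sets_eq(1) refl])
qed

lemma chordal_energy_expansion:
  "complex_of_real (chordal_energy k \<nu> \<mu>) =
     (\<Sum>i\<le>k. \<Sum>j\<le>k. of_nat (k choose i) * of_nat (k choose j)
        * (chordal_moment \<nu> k i j * cnj (chordal_moment \<mu> k i j)))"
proof -
  have "complex_of_real (chordal_energy k \<nu> \<mu>) = (LINT z|\<nu>. (\<Sum>i\<le>k. \<Sum>j\<le>k. of_nat (k choose i) * of_nat (k choose j)
        * (chordal_mono k i j z * cnj (chordal_moment \<mu> k i j))))"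
    unfolding chordal_energy_def
    by (subst integral_complex_of_real[symmetric], subst integral_kap_power[OF prob(2) sets_eq(2)]) simp
  also have "\<dots> = (\<Sum>i\<le>k. \<Sum>j\<le>k. of_nat (k choose i) * of_nat (k choose j)
        * (chordal_moment \<nu> k i j * cnj (chordal_moment \<mu> k i j)))"
    unfolding chordal_moment_def[of \<nu>]
    by (subst Bochner_Integration.integral_sum, (intro Bochner_Integration.integrable_sum integrable_mult_right integrable_mult_left integrable_chordal_mono prob sets_eq; simp; fail),
        subst Bochner_Integration.integral_sum, (intro Bochner_Integration.integrable_sum integrable_mult_right integrable_mult_left integrable_chordal_mono prob sets_eq; simp; fail)) simp
  finally show ?thesis .
qed

lemma chordal_energy_nonneg: "0 \<le> chordal_energy k \<nu> \<mu>"
  using integral_kap_power_bounds(1)[OF prob(2) sets_eq(2)] by (simp add: chordal_energy_def)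

lemma nn_integral_chordal_log:
  "(\<integral>\<^sup>+ z. (\<integral>\<^sup>+ w. chordal_log z w \<partial>\<mu>) \<partial>\<nu>) = (\<Sum>k. ennreal (chordal_energy k \<nu> \<mu> / real k))"
proof -
  have inner: "(\<integral>\<^sup>+ w. ennreal (kap z w ^ k / real k) \<partial>\<mu>) = ennreal ((LINT w|\<mu>. kap z w ^ k) / real k)" for z k
    using integrable_kap_power[OF prob(2) sets_eq(2)] kap_nonneg
    by (subst nn_integral_eq_integral) auto
  have meas1: "(\<lambda>w. ennreal (kap z w ^ k / real k)) \<in> borel_measurable \<mu>" for z k
    using integrable_kap_power[OF prob(2) sets_eq(2)] by measurable
  have meas2: "(\<lambda>z. ennreal ((LINT w|\<mu>. kap z w ^ k) / real k)) \<in> borel_measurable \<nu>" for k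
    using integrable_integral_kap_power by measurable
  have "(\<integral>\<^sup>+ z. (\<integral>\<^sup>+ w. chordal_log z w \<partial>\<mu>) \<partial>\<nu>)
      = (\<integral>\<^sup>+ z. (\<Sum>k. ennreal ((LINT w|\<mu>. kap z w ^ k) / real k)) \<partial>\<nu>)"
    unfolding chordal_log_def nn_integral_suminf[OF meas1] inner ..
  also have "\<dots> = (\<Sum>k. \<integral>\<^sup>+ z. ennreal ((LINT w|\<mu>. kap z w ^ k) / real k) \<partial>\<nu>)"
    by (rule nn_integral_suminf[OF meas2])
  also have "\<dots> = (\<Sum>k. ennreal (chordal_energy k \<nu> \<mu> / real k))"
    unfolding chordal_energy_def
    using integrable_integral_kap_power integral_kap_power_bounds(1)[OF prob(2) sets_eq(2)]
    by (subst nn_integral_eq_integral) auto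
  finally show ?thesis .
qed

end

text \<open>This is the quadratic form of the kernel at the signed measure \<nu> - \<mu>. All
  weights are positive for i, j <= k, so its vanishing makes every one of these moments
  agree.\<close>

lemma chordal_energy_diff:
  fixes \<nu> \<mu> :: "complex measure"
  assumes prob: "prob_space \<nu>" "prob_space \<mu>"
    and sets_eq: "sets \<nu> = sets borel" "sets \<mu> = sets borel"
  shows "chordal_energy k \<nu> \<nu> + chordal_energy k \<mu> \<mu> - 2 * chordal_energy k \<nu> \<mu> =
    (\<Sum>i\<le>k. \<Sum>j\<le>k. real (k choose i) * real (k choose j)
       * (cmod (chordal_moment \<nu> k i j - chordal_moment \<mu> k i j))\<^sup>2)"
proof -
  have "cnj (complex_of_real (chordal_energy k \<mu> \<nu>)) = complex_of_real (chordal_energy k \<nu> \<mu>)"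
    unfolding chordal_energy_expansion[OF prob sets_eq]
       chordal_energy_expansion[OF prob(2,1) sets_eq(2,1)]
    by (simp add: mult.commute)
  then have sym: "chordal_energy k \<mu> \<nu> = chordal_energy k \<nu> \<mu>"
    by (simp only: complex_cnj_complex_of_real of_real_eq_iff)
  have "complex_of_real (chordal_energy k \<nu> \<nu> + chordal_energy k \<mu> \<mu> - chordal_energy k \<nu> \<mu> - chordal_energy k \<mu> \<nu>)
    = complex_of_real (\<Sum>i\<le>k. \<Sum>j\<le>k. real (k choose i) * real (k choose j)
       * (cmod (chordal_moment \<nu> k i j - chordal_moment \<mu> k i j))\<^sup>2)"
    unfolding of_real_add of_real_diff of_real_sum of_real_mult of_real_of_nat_eq complex_norm_square
       chordal_energy_expansion[OF prob sets_eq]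
       chordal_energy_expansion[OF prob(2,1) sets_eq(2,1)]
       chordal_energy_expansion[OF prob(1,1) sets_eq(1,1)]
       chordal_energy_expansion[OF prob(2,2) sets_eq(2,2)]
       sum.distrib[symmetric] sum_subtractf[symmetric]
    by (intro sum.cong refl) (simp add: algebra_simps)
  then show ?thesis
    unfolding sym of_real_eq_iff by simp
qed

section \<open>Measures of constant potential\<close>

definition wt_integral :: "complex measure \<Rightarrow> real" where
  "wt_integral \<nu> = (LINT z|\<nu>. ln (wt z))"

lemma sums_of_suminf_ennreal:
  fixes f :: "nat \<Rightarrow> real"
  assumes "\<And>n. f n \<ge> 0" "(\<Sum>n. ennreal (f n)) = ennreal x" "x \<ge> 0"
  shows "f sums x"
proof -
  have sm: "summable f"
    using assms by (intro summable_suminf_not_top) auto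
  have eq: "ennreal (suminf f) = ennreal x"
    using suminf_ennreal2[OF assms(1) sm] assms(2) by simp
  have "suminf f = x"
    using eq assms(3) suminf_nonneg[OF sm assms(1)] by (simp only: ennreal_inj)
  with sm show ?thesis by (simp add: sums_iff)
qed

lemma prob_measures_onD:
  assumes "\<nu> \<in> prob_measures_on E"
  shows "prob_space \<nu>" "sets \<nu> = sets borel" "AE z in \<nu>. z \<in> E"
  using assms by (auto simp: prob_measures_on_def)

lemma ln_wt_nonneg: "0 \<le> ln (wt z)"
  using wt_ge_1[of z] by simp

lemma integrable_ln_wt:
  assumes \<nu>: "\<nu> \<in> prob_measures_on E" and E: "bounded E"
  shows "integrable \<nu> (\<lambda>z. ln (wt z))"
proof -
  note [measurable_cong] = prob_measures_onD(2)[OF \<nu>]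
  interpret prob_space \<nu> by (rule prob_measures_onD[OF \<nu>])
  obtain B where B: "\<And>z. z \<in> E \<Longrightarrow> cmod z \<le> B"
    using E by (auto simp: bounded_iff)
  have le: "norm (ln (wt z)) \<le> ln (1 + B\<^sup>2)" if "z \<in> E" for z
  proof -
    have "wt z \<le> 1 + B\<^sup>2"
      using B[OF that] by (simp add: wt_def power_mono)
    then show ?thesis
      using wt_ge_1[of z] by simp
  qed
  show ?thesis
    by (rule integrable_const_bound[where B = "ln (1 + B\<^sup>2)"])
      (use prob_measures_onD(3)[OF \<nu>] le in auto)
qed

text \<open>Integrating \<open>log_kernel_split\<close> twice gives 2 P + 2 W = F + 2 N, where P and
  N are the two parts of the energy and W is \<open>wt_integral \<nu>\<close>. Since W and N are
  finite, P is infinite together with F, and otherwise the identity can be solved for P - N.\<close>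

lemma log_energy_chordal:
  assumes \<nu>: "\<nu> \<in> prob_measures_on E" and E: "bounded E"
  defines "F \<equiv> \<integral>\<^sup>+ z. (\<integral>\<^sup>+ w. chordal_log z w \<partial>\<nu>) \<partial>\<nu>"
  shows "F = top \<Longrightarrow> log_energy \<nu> = \<infinity>"
    and "F = ennreal x \<Longrightarrow> x \<ge> 0 \<Longrightarrow> log_energy \<nu> = ereal (x / 2 - wt_integral \<nu>)"
proof -
  note meas [measurable_cong] = prob_measures_onD(2)[OF \<nu>]
  interpret prob_space \<nu> by (rule prob_measures_onD[OF \<nu>])
  define P where "P = (\<integral>\<^sup>+ z. (\<integral>\<^sup>+ w. e2ennreal (log_kernel z w) \<partial>\<nu>) \<partial>\<nu>)"
  define N where "N = (\<integral>\<^sup>+ z. (\<integral>\<^sup>+ w. e2ennreal (- log_kernel z w) \<partial>\<nu>) \<partial>\<nu>)"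
  have E1: "log_energy \<nu> = enn2ereal P - enn2ereal N"
    by (simp add: log_energy_def P_def N_def)
  have meas_inner: "(\<lambda>w. f z w) \<in> borel_measurable \<nu>"
    if "(\<lambda>p. f (fst p) (snd p)) \<in> borel_measurable (borel \<Otimes>\<^sub>M borel)"
    for f :: "complex \<Rightarrow> complex \<Rightarrow> ennreal" and z
  proof -
    have "(\<lambda>w. f (fst (z, w)) (snd (z, w))) \<in> borel_measurable \<nu>"
      using that by measurable
    then show ?thesis by simp
  qed
  have meas_outer: "(\<lambda>z. \<integral>\<^sup>+ w. f z w \<partial>\<nu>) \<in> borel_measurable \<nu>"
    if "(\<lambda>p. f (fst p) (snd p)) \<in> borel_measurable (borel \<Otimes>\<^sub>M borel)"
    for f :: "complex \<Rightarrow> complex \<Rightarrow> ennreal"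
  proof -
    have "(\<lambda>p. f (fst p) (snd p)) \<in> borel_measurable (\<nu> \<Otimes>\<^sub>M \<nu>)"
      using that by measurable
    then show ?thesis
      by (intro borel_measurable_nn_integral) (simp add: case_prod_beta)
  qed
  have add2: "(\<integral>\<^sup>+ z. (\<integral>\<^sup>+ w. f z w + g z w \<partial>\<nu>) \<partial>\<nu>) =
     (\<integral>\<^sup>+ z. (\<integral>\<^sup>+ w. f z w \<partial>\<nu>) \<partial>\<nu>) + (\<integral>\<^sup>+ z. (\<integral>\<^sup>+ w. g z w \<partial>\<nu>) \<partial>\<nu>)"
    if "(\<lambda>p. f (fst p) (snd p)) \<in> borel_measurable (borel \<Otimes>\<^sub>M borel)"
       "(\<lambda>p. g (fst p) (snd p)) \<in> borel_measurable (borel \<Otimes>\<^sub>M borel)"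
    for f g :: "complex \<Rightarrow> complex \<Rightarrow> ennreal"
    using that by (simp add: nn_integral_add meas_inner meas_outer)
  have mult2: "(\<integral>\<^sup>+ z. (\<integral>\<^sup>+ w. 2 * f z w \<partial>\<nu>) \<partial>\<nu>) = 2 * (\<integral>\<^sup>+ z. (\<integral>\<^sup>+ w. f z w \<partial>\<nu>) \<partial>\<nu>)"
    if "(\<lambda>p. f (fst p) (snd p)) \<in> borel_measurable (borel \<Otimes>\<^sub>M borel)"
    for f :: "complex \<Rightarrow> complex \<Rightarrow> ennreal"
    using that by (simp add: nn_integral_cmult meas_inner meas_outer)
  have C: "(\<integral>\<^sup>+ z. (\<integral>\<^sup>+ w. ennreal (ln (wt z) + ln (wt w)) \<partial>\<nu>) \<partial>\<nu>) = ennreal (2 * wt_integral \<nu>)"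
  proof -
    have i: "integrable \<nu> (\<lambda>z. ln (wt z))" by (rule integrable_ln_wt[OF \<nu> E])
    have "(\<integral>\<^sup>+ w. ennreal (ln (wt z) + ln (wt w)) \<partial>\<nu>) = ennreal (ln (wt z) + wt_integral \<nu>)" for z
      unfolding wt_integral_def using i ln_wt_nonneg
      by (subst nn_integral_eq_integral) (auto simp: prob_space)
    moreover have "wt_integral \<nu> \<ge> 0"
      unfolding wt_integral_def by (simp add: ln_wt_nonneg)
    moreover have "(\<integral>\<^sup>+ z. ennreal (ln (wt z) + wt_integral \<nu>) \<partial>\<nu>)
        = ennreal (LINT z|\<nu>. ln (wt z) + wt_integral \<nu>)"
      using i ln_wt_nonneg \<open>wt_integral \<nu> \<ge> 0\<close> by (intro nn_integral_eq_integral) auto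
    ultimately show ?thesis
      using i by (simp add: prob_space wt_integral_def)
  qed
  have eq: "2 * P + ennreal (2 * wt_integral \<nu>) = F + 2 * N"
  proof -
    have "2 * P + ennreal (2 * wt_integral \<nu>)
        = (\<integral>\<^sup>+ z. (\<integral>\<^sup>+ w. 2 * e2ennreal (log_kernel z w) + ennreal (ln (wt z) + ln (wt w)) \<partial>\<nu>) \<partial>\<nu>)"
      unfolding P_def C[symmetric] by (subst add2; (subst mult2)?; measurable)
    also have "\<dots> = (\<integral>\<^sup>+ z. (\<integral>\<^sup>+ w. chordal_log z w + 2 * e2ennreal (- log_kernel z w) \<partial>\<nu>) \<partial>\<nu>)"
      by (simp only: log_kernel_split)
    also have "\<dots> = F + 2 * N"
      unfolding F_def N_def by (subst add2; (subst mult2)?; measurable)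
    finally show ?thesis .
  qed
  \<comment> \<open>Nonnegativity of the chordal kernel says that twice ln |z - w| is at most the
    sum of the weight terms, so these dominate the negative part.\<close>
  have Nfin: "N < top"
  proof -
    have "e2ennreal (- log_kernel z w) \<le> ennreal (ln (wt z) + ln (wt w))" for z w
    proof (cases "z = w")
      case False
      define x where "x = ln (1 / dist z w)"
      have *: "2 * x + (ln (wt z) + ln (wt w)) \<ge> 0"
        unfolding x_def by (rule chordal_log_value_nonneg[OF False])
      have "- x \<le> ln (wt z) + ln (wt w)"
        using * ln_wt_nonneg[of z] ln_wt_nonneg[of w] by linarith
      moreover have "- log_kernel z w = ereal (- x)"
        using False by (simp add: log_kernel_def x_def)
      ultimately show ?thesis
        by (simp only: e2ennreal_ereal ennreal_leI)
    qed (simp add: log_kernel_def e2ennreal_neg)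
    then have "N \<le> (\<integral>\<^sup>+ z. (\<integral>\<^sup>+ w. ennreal (ln (wt z) + ln (wt w)) \<partial>\<nu>) \<partial>\<nu>)"
      unfolding N_def by (intro nn_integral_mono)
    then show ?thesis
      unfolding C by (simp add: order_le_less_trans)
  qed
  then obtain n where n: "N = ennreal n" "n \<ge> 0"
    by (cases N) auto
  have a0: "wt_integral \<nu> \<ge> 0"
    unfolding wt_integral_def by (simp add: ln_wt_nonneg)
  {
    assume "F = top"
    with eq have "2 * P + ennreal (2 * wt_integral \<nu>) = top"
      by simp
    then have "P = top"
      by (auto simp: ennreal_mult_eq_top_iff)
    then show "log_energy \<nu> = \<infinity>"
      using n by (simp add: E1)
  next
    assume F: "F = ennreal x" "x \<ge> 0"
    with eq n have "2 * P + ennreal (2 * wt_integral \<nu>) \<noteq> top"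
      by (simp add: ennreal_mult_eq_top_iff)
    then have "P \<noteq> top"
      by (auto simp: ennreal_mult_eq_top_iff)
    then obtain p where p: "P = ennreal p" "p \<ge> 0"
      by (cases P) auto
    have two: "2 * ennreal y = ennreal (2 * y)" for y
      by (metis ennreal_mult' ennreal_numeral zero_le_numeral)
    have "2 * p + 2 * wt_integral \<nu> = x + 2 * n"
      using eq unfolding p n F(1) two using p n a0 F(2)
      by (simp flip: ennreal_plus)
    then have "p - n = x / 2 - wt_integral \<nu>"
      by simp
    then show "log_energy \<nu> = ereal (x / 2 - wt_integral \<nu>)"
      using p n by (simp add: E1)
  }
qed

text \<open>Up to the factor \<open>2\<close>, \<open>log_energy \<nu> - \<gamma>\<close> is the series of the nonnegative quantities of
  \<open>chordal_energy_diff\<close> divided by \<open>k\<close>.\<close>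

lemma energy_comparison:
  assumes E: "bounded E" and \<nu>: "\<nu> \<in> prob_measures_on E" and \<mu>: "\<mu> \<in> prob_measures_on E"
    and atom: "\<And>z. z \<in> E \<Longrightarrow> AE w in \<mu>. w \<noteq> z"
    and int: "\<And>z. z \<in> E \<Longrightarrow> integrable \<mu> (\<lambda>w. ln (dist z w))"
    and pot: "\<And>z. z \<in> E \<Longrightarrow> (LINT w|\<mu>. ln (dist z w)) = - \<gamma>"
  shows "log_energy \<mu> = ereal \<gamma>" "ereal \<gamma> \<le> log_energy \<nu>"
    "log_energy \<nu> = ereal \<gamma> \<Longrightarrow> i \<le> k \<Longrightarrow> j \<le> k \<Longrightarrow> chordal_moment \<nu> k i j = chordal_moment \<mu> k i j"
proof -
  note [measurable_cong] = prob_measures_onD(2)[OF \<nu>] prob_measures_onD(2)[OF \<mu>]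
  note pr = prob_measures_onD(1)[OF \<nu>] prob_measures_onD(1)[OF \<mu>]
  note st = prob_measures_onD(2)[OF \<nu>] prob_measures_onD(2)[OF \<mu>]
  interpret N: prob_space \<nu> by (rule pr)
  interpret M: prob_space \<mu> by (rule pr)
  \<comment> \<open>The absence of atoms enters here: on the diagonal \<open>chordal_log\<close> is
    infinite while \<open>ln (dist z z)\<close> is 0 by convention, so the two expressions can agree
    only almost everywhere.\<close>
  have pot1: "(\<integral>\<^sup>+ w. chordal_log z w \<partial>\<mu>) = ennreal (2 * \<gamma> + wt_integral \<mu> + ln (wt z))"
    "2 * \<gamma> + wt_integral \<mu> + ln (wt z) \<ge> 0" if z: "z \<in> E" for z
  proof -
    let ?g = "\<lambda>w. (-2) * ln (dist z w) + (ln (wt z) + ln (wt w))"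
    have i: "integrable \<mu> ?g"
      using int[OF z] integrable_ln_wt[OF \<mu> E] by auto
    have eq: "LINT w|\<mu>. ?g w = 2 * \<gamma> + wt_integral \<mu> + ln (wt z)"
    proof -
      have "LINT w|\<mu>. ?g w = (LINT w|\<mu>. (-2) * ln (dist z w)) + (LINT w|\<mu>. ln (wt z) + ln (wt w))"
        using int[OF z] integrable_ln_wt[OF \<mu> E] by (intro Bochner_Integration.integral_add) auto
      also have "(LINT w|\<mu>. ln (wt z) + ln (wt w)) = ln (wt z) + wt_integral \<mu>"
        unfolding wt_integral_def using integrable_ln_wt[OF \<mu> E] by (simp add: M.prob_space)
      finally show ?thesis using pot[OF z] by simp
    qed
    have nonneg: "?g w \<ge> 0" if "w \<noteq> z" for w
      using chordal_log_value_nonneg[of z w] that by (simp add: ln_div)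
    have AEnn: "AE w in \<mu>. 0 \<le> ?g w"
      using atom[OF z] by eventually_elim (rule nonneg)
    have "(\<integral>\<^sup>+ w. chordal_log z w \<partial>\<mu>) = (\<integral>\<^sup>+ w. ennreal (?g w) \<partial>\<mu>)"
    proof (rule nn_integral_cong_AE)
      show "AE w in \<mu>. chordal_log z w = ennreal (?g w)"
        using atom[OF z]
      proof eventually_elim
        case (elim w)
        then show ?case
          using chordal_log_neq[of z w] by (simp add: ln_div)
      qed
    qed
    also have "\<dots> = ennreal (LINT w|\<mu>. ?g w)"
      by (intro nn_integral_eq_integral i AEnn)
    finally show "(\<integral>\<^sup>+ w. chordal_log z w \<partial>\<mu>) = ennreal (2 * \<gamma> + wt_integral \<mu> + ln (wt z))"
      unfolding eq .
    have "0 \<le> (LINT w|\<mu>. ?g w)"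
      by (intro integral_nonneg_AE AEnn)
    then show "2 * \<gamma> + wt_integral \<mu> + ln (wt z) \<ge> 0"
      unfolding eq .
  qed
  \<comment> \<open>As the potential of \<mu> is constant on E, its mixed energy with any \<rho> on
    E is known in advance. This serves both for \<rho> = \<mu> and for \<rho> = \<nu>.\<close>
  have mixed: "(\<lambda>k. chordal_energy k \<rho> \<mu> / real k) sums (2 * \<gamma> + wt_integral \<mu> + wt_integral \<rho>)
      \<and> 2 * \<gamma> + wt_integral \<mu> + wt_integral \<rho> \<ge> 0
      \<and> (\<integral>\<^sup>+ z. (\<integral>\<^sup>+ w. chordal_log z w \<partial>\<mu>) \<partial>\<rho>) = ennreal (2 * \<gamma> + wt_integral \<mu> + wt_integral \<rho>)"
    if \<rho>: "\<rho> \<in> prob_measures_on E" for \<rho>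
  proof -
    note AE\<rho> = prob_measures_onD(3)[OF \<rho>]
    interpret R: prob_space \<rho> by (rule prob_measures_onD[OF \<rho>])
    have eq: "(LINT z|\<rho>. 2 * \<gamma> + wt_integral \<mu> + ln (wt z)) = 2 * \<gamma> + wt_integral \<mu> + wt_integral \<rho>"
      using integrable_ln_wt[OF \<rho> E] by (simp add: wt_integral_def R.prob_space)
    have "(\<integral>\<^sup>+ z. (\<integral>\<^sup>+ w. chordal_log z w \<partial>\<mu>) \<partial>\<rho>) = (\<integral>\<^sup>+ z. ennreal (2 * \<gamma> + wt_integral \<mu> + ln (wt z)) \<partial>\<rho>)"
      using AE\<rho> by (intro nn_integral_cong_AE) (auto elim!: eventually_mono simp: pot1)
    also have "\<dots> = ennreal (2 * \<gamma> + wt_integral \<mu> + wt_integral \<rho>)"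
      unfolding eq[symmetric] using AE\<rho> integrable_ln_wt[OF \<rho> E]
      by (intro nn_integral_eq_integral) (auto elim!: eventually_mono simp: pot1)
    finally have 1: "(\<integral>\<^sup>+ z. (\<integral>\<^sup>+ w. chordal_log z w \<partial>\<mu>) \<partial>\<rho>) = ennreal (2 * \<gamma> + wt_integral \<mu> + wt_integral \<rho>)" .
    have 2: "2 * \<gamma> + wt_integral \<mu> + wt_integral \<rho> \<ge> 0"
      unfolding eq[symmetric] using AE\<rho>
      by (intro integral_nonneg_AE) (auto elim!: eventually_mono simp: pot1)
    have "(\<lambda>k. chordal_energy k \<rho> \<mu> / real k) sums (2 * \<gamma> + wt_integral \<mu> + wt_integral \<rho>)"
      using 1 2 prob_measures_onD(1,2)[OF \<rho>] pr st
      by (intro sums_of_suminf_ennreal) (auto simp: nn_integral_chordal_log chordal_energy_nonneg)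
    with 1 2 show ?thesis by simp
  qed
  show "log_energy \<mu> = ereal \<gamma>"
    using log_energy_chordal(2)[OF \<mu> E] mixed[OF \<mu>] by (simp add: add_divide_distrib)
  define S where "S = (\<integral>\<^sup>+ z. (\<integral>\<^sup>+ w. chordal_log z w \<partial>\<nu>) \<partial>\<nu>)"
  define D where "D k = chordal_energy k \<nu> \<nu> + chordal_energy k \<mu> \<mu> - 2 * chordal_energy k \<nu> \<mu>" for k
  have D: "D k = (\<Sum>i\<le>k. \<Sum>j\<le>k. real (k choose i) * real (k choose j)
       * (cmod (chordal_moment \<nu> k i j - chordal_moment \<mu> k i j))\<^sup>2)" for k
    unfolding D_def by (rule chordal_energy_diff[OF pr st])
  have D0: "D k \<ge> 0" for k
    unfolding D by (intro sum_nonneg) auto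
  have fin: "\<exists>e. log_energy \<nu> = ereal e \<and> (\<lambda>k. D k / real k) sums (2 * (e - \<gamma>))" if "S \<noteq> top"
  proof -
    obtain x where x: "S = ennreal x" "x \<ge> 0"
      using \<open>S \<noteq> top\<close> by (cases S) auto
    have "(\<lambda>k. chordal_energy k \<nu> \<nu> / real k) sums x"
      using x pr st unfolding S_def
      by (intro sums_of_suminf_ennreal) (auto simp: nn_integral_chordal_log chordal_energy_nonneg)
    then have "(\<lambda>k. chordal_energy k \<nu> \<nu> / real k + chordal_energy k \<mu> \<mu> / real k
        - 2 * (chordal_energy k \<nu> \<mu> / real k)) sums
       (x + (2 * \<gamma> + wt_integral \<mu> + wt_integral \<mu>) - 2 * (2 * \<gamma> + wt_integral \<mu> + wt_integral \<nu>))"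
      using mixed[OF \<mu>] mixed[OF \<nu>] by (intro sums_add sums_diff sums_mult) auto
    \<comment> \<open>The three sums combine to x - 2 \<gamma> - 2 \<open>wt_integral \<nu>\<close>;
      the integral over \<mu> cancels.\<close>
    then have "(\<lambda>k. D k / real k) sums (2 * ((x / 2 - wt_integral \<nu>) - \<gamma>))"
      by (simp add: D_def add_divide_distrib diff_divide_distrib algebra_simps)
    moreover have "log_energy \<nu> = ereal (x / 2 - wt_integral \<nu>)"
      using log_energy_chordal(2)[OF \<nu> E] x by (simp add: S_def)
    ultimately show ?thesis by blast
  qed
  have top: "log_energy \<nu> = \<infinity>" if "S = top"
    using log_energy_chordal(1)[OF \<nu> E] that by (simp add: S_def)
  show "ereal \<gamma> \<le> log_energy \<nu>"
  proof (cases "S = top")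
    case False
    then obtain e where e: "log_energy \<nu> = ereal e" "(\<lambda>k. D k / real k) sums (2 * (e - \<gamma>))"
      using fin by blast
    have "2 * (e - \<gamma>) \<ge> 0"
      using D0 by (intro sums_le[OF _ sums_zero e(2)]) simp
    then show ?thesis by (simp add: e)
  qed (simp add: top)
  assume eq: "log_energy \<nu> = ereal \<gamma>" and ij: "i \<le> k" "j \<le> k"
  show "chordal_moment \<nu> k i j = chordal_moment \<mu> k i j"
  proof (cases "k = 0")
    \<comment> \<open>The term k = 0 of the series is 0 whatever the measures are, so it carries no
      information; but its only moment is the total mass.\<close>
    case True
    with ij show ?thesis
      by (simp add: chordal_moment_def chordal_mono_def N.prob_space M.prob_space)
  next
    case False
    from eq top have "S \<noteq> top" by auto
    with fin eq have s0: "(\<lambda>k. D k / real k) sums 0" by auto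
    then have "D k / real k = 0"
      using D0 suminf_eq_zero_iff[of "\<lambda>k. D k / real k"] by (auto simp: sums_iff)
    then have "D k = 0" using False by simp
    then have "real (k choose i) * real (k choose j)
       * (cmod (chordal_moment \<nu> k i j - chordal_moment \<mu> k i j))\<^sup>2 = 0"
      unfolding D using ij by (simp add: sum_nonneg_eq_0_iff sum_nonneg)
    then show ?thesis using ij by simp
  qed
qed

section \<open>Density of the chordal functions and uniqueness of the minimizer\<close>

inductive_set chordal_span :: "(complex \<Rightarrow> complex) set" where
  mono: "i \<le> k \<Longrightarrow> j \<le> k \<Longrightarrow> chordal_mono k i j \<in> chordal_span"
| add: "f \<in> chordal_span \<Longrightarrow> g \<in> chordal_span \<Longrightarrow> (\<lambda>z. f z + g z) \<in> chordal_span"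
| scale: "f \<in> chordal_span \<Longrightarrow> (\<lambda>z. c * f z) \<in> chordal_span"

lemma chordal_mono_mult:
  "chordal_mono k i j z * chordal_mono k' i' j' z = chordal_mono (k + k') (i + i') (j + j') z"
  by (simp add: chordal_mono_def power_add)

text \<open>Multiplication adds the indices, and the constraint i, j <= k is preserved by addition.
  Both factors range over the span, hence the nested inductions.\<close>

lemma chordal_span_mult:
  assumes "f \<in> chordal_span" "g \<in> chordal_span"
  shows "(\<lambda>z. f z * g z) \<in> chordal_span"
  using assms(1)
proof induction
  case (mono i k j)
  note ij = mono
  show ?case
    using assms(2)
  proof induction
    case (mono i' k' j')
    then show ?case
      using ij unfolding chordal_mono_mult
      by (metis (no_types, lifting) add_mono chordal_span.mono ext)
  next
    case (add f g)
    then show ?case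
      using chordal_span.add[of "\<lambda>z. chordal_mono k i j z * f z" "\<lambda>z. chordal_mono k i j z * g z"]
      by (simp add: distrib_left)
  next
    case (scale f c)
    then show ?case
      using chordal_span.scale[of "\<lambda>z. chordal_mono k i j z * f z" c]
      by (simp add: mult.left_commute)
  qed
next
  case (add f1 f2)
  then show ?case
    using chordal_span.add[of "\<lambda>z. f1 z * g z" "\<lambda>z. f2 z * g z"]
    by (simp add: distrib_right)
next
  case (scale f c)
  then show ?case
    using chordal_span.scale[of "\<lambda>z. f z * g z" c]
    by (simp add: mult.assoc)
qed

lemma chordal_span_continuous: "f \<in> chordal_span \<Longrightarrow> continuous_on S f"
  by (induction rule: chordal_span.induct) (auto intro!: continuous_intros continuous_chordal_mono)

lemma chordal_span_integral_eq:
  assumes pr: "prob_space \<nu>" "prob_space \<mu>"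
    and st: "sets \<nu> = sets borel" "sets \<mu> = sets borel"
    and mom: "\<And>k i j. i \<le> k \<Longrightarrow> j \<le> k \<Longrightarrow> chordal_moment \<nu> k i j = chordal_moment \<mu> k i j"
    and f: "f \<in> chordal_span"
  shows "integrable \<nu> f \<and> integrable \<mu> f \<and> (LINT z|\<nu>. f z) = (LINT z|\<mu>. f z)"
  using f
proof induction
  case (mono i k j)
  then show ?case
    using mom[of i k j] integrable_chordal_mono[OF pr(1) st(1)] integrable_chordal_mono[OF pr(2) st(2)]
    by (simp add: chordal_moment_def)
next
  case (add f g)
  then show ?case by (simp add: Bochner_Integration.integral_add)
next
  case (scale f c)
  then show ?case by simp
qed

text \<open>The Stone-Weierstrass theorem used here is the one for real functions, hence the
  embedding by \<open>complex_of_real\<close>. Points are separated by 1, Re z and Im z, each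
  divided by \<open>wt z\<close>; the last two are combinations of \<open>chordal_mono 1 1 0\<close>
  and its conjugate \<open>chordal_mono 1 0 1\<close>.\<close>

lemma chordal_function_ring:
  assumes "compact S"
  shows "function_ring_on {f. (\<lambda>z. complex_of_real (f z)) \<in> chordal_span} S"
proof
  show "compact S" by fact
next
  fix f :: "complex \<Rightarrow> real"
  assume "f \<in> {f. (\<lambda>z. complex_of_real (f z)) \<in> chordal_span}"
  then have "continuous_on S (\<lambda>z. Re (complex_of_real (f z)))"
    by (intro continuous_on_Re chordal_span_continuous) simp
  then show "continuous_on S f" by simp
next
  fix f g :: "complex \<Rightarrow> real"
  assume "f \<in> {f. (\<lambda>z. complex_of_real (f z)) \<in> chordal_span}"
    "g \<in> {f. (\<lambda>z. complex_of_real (f z)) \<in> chordal_span}"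
  then show "(\<lambda>x. f x + g x) \<in> {f. (\<lambda>z. complex_of_real (f z)) \<in> chordal_span}"
      "(\<lambda>x. f x * g x) \<in> {f. (\<lambda>z. complex_of_real (f z)) \<in> chordal_span}"
    using chordal_span.add chordal_span_mult by auto
next
  fix c :: real
  have "(\<lambda>z. of_real c * chordal_mono 0 0 0 z) \<in> chordal_span"
    by (intro chordal_span.intros) auto
  then show "(\<lambda>_. c) \<in> {f. (\<lambda>z. complex_of_real (f z)) \<in> chordal_span}"
    by (simp add: chordal_mono_def)
next
  fix x y :: complex
  assume "x \<noteq> y"
  have inv: "(\<lambda>z. complex_of_real (1 / wt z)) \<in> chordal_span"
    using chordal_span.mono[of 0 1 0] by (simp add: chordal_mono_def[abs_def])
  have re: "(\<lambda>z. complex_of_real (Re z / wt z)) \<in> chordal_span"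
  proof -
    have "(\<lambda>z. (1/2) * chordal_mono 1 1 0 z + (1/2) * chordal_mono 1 0 1 z) \<in> chordal_span"
      by (intro chordal_span.intros) auto
    moreover have "(1/2) * chordal_mono 1 1 0 z + (1/2) * chordal_mono 1 0 1 z
       = complex_of_real (Re z / wt z)" for z
      using wt_nonzero[of z]
      by (simp add: chordal_mono_def add_divide_distrib[symmetric] complex_add_cnj)
    ultimately show ?thesis by simp
  qed
  have im: "(\<lambda>z. complex_of_real (Im z / wt z)) \<in> chordal_span"
  proof -
    have "(\<lambda>z. (-\<i>/2) * chordal_mono 1 1 0 z + (\<i>/2) * chordal_mono 1 0 1 z) \<in> chordal_span"
      by (intro chordal_span.intros) auto
    moreover have "(-\<i>/2) * chordal_mono 1 1 0 z + (\<i>/2) * chordal_mono 1 0 1 z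
       = complex_of_real (Im z / wt z)" for z
      using wt_nonzero[of z]
      by (simp add: chordal_mono_def complex_eq_iff field_simps)
    ultimately show ?thesis by simp
  qed
  \<comment> \<open>If the first quotients agree then so do the weights, and the other two then
    compare the coordinates themselves.\<close>
  have "1 / wt x \<noteq> 1 / wt y \<or> Re x / wt x \<noteq> Re y / wt y \<or> Im x / wt x \<noteq> Im y / wt y"
    using \<open>x \<noteq> y\<close> wt_nonzero[of x] wt_nonzero[of y] by (auto simp: complex_eq_iff)
  then show "\<exists>f\<in>{f. (\<lambda>z. complex_of_real (f z)) \<in> chordal_span}. f x \<noteq> f y"
  proof (elim disjE)
    assume "1 / wt x \<noteq> 1 / wt y"
    then show ?thesis using inv by (intro bexI[of _ "\<lambda>z. 1 / wt z"]) simp_all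
  next
    assume "Re x / wt x \<noteq> Re y / wt y"
    then show ?thesis using re by (intro bexI[of _ "\<lambda>z. Re z / wt z"]) simp_all
  next
    assume "Im x / wt x \<noteq> Im y / wt y"
    then show ?thesis using im by (intro bexI[of _ "\<lambda>z. Im z / wt z"]) simp_all
  qed
qed

text \<open>Closed sets form a generator stable under intersection, and the indicator of a nonempty
  closed set C is the limit of the continuous functions max 0 (1 - n dist(z, C)), dominated by
  1.\<close>

lemma measure_eqI_continuous_integrals:
  fixes \<nu> \<mu> :: "complex measure"
  assumes pr: "prob_space \<nu>" "prob_space \<mu>"
    and st: "sets \<nu> = sets borel" "sets \<mu> = sets borel"
    and eq: "\<And>f :: complex \<Rightarrow> real. continuous_on UNIV f \<Longrightarrow> (\<And>x. \<bar>f x\<bar> \<le> 1) \<Longrightarrow>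
        (LINT z|\<nu>. f z) = (LINT z|\<mu>. f z)"
  shows "\<nu> = \<mu>"
proof (rule measure_eqI_generator_eq[where E = "Collect closed" and \<Omega> = UNIV and A = "\<lambda>_. UNIV"])
  show "Int_stable (Collect closed :: complex set set)"
    by (auto simp: Int_stable_def)
  show "sets \<nu> = sigma_sets UNIV (Collect closed)" "sets \<mu> = sigma_sets UNIV (Collect closed)"
    by (simp_all add: st borel_eq_closed)
  show "emeasure \<nu> UNIV \<noteq> \<infinity>"
    using pr(1) prob_space.emeasure_space_1 sets_eq_imp_space_eq[OF st(1)] by fastforce
  fix C :: "complex set" assume "C \<in> Collect closed"
  then have C: "closed C" by simp
  define h where "h n z = max 0 (1 - real n * infdist z C)" for n z
  have h01: "0 \<le> h n z" "h n z \<le> 1" for n z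
    by (auto simp: h_def infdist_nonneg)
  have hc: "continuous_on UNIV (h n)" for n
    unfolding h_def[abs_def] by (intro continuous_intros)
  have lim: "(\<lambda>n. LINT z|\<rho>. h n z) \<longlonglongrightarrow> measure \<rho> C"
    if \<rho>: "prob_space \<rho>" "sets \<rho> = sets borel" and "C \<noteq> {}" for \<rho>
  proof -
    interpret prob_space \<rho> by fact
    note [measurable_cong] = \<rho>(2)
    have [measurable]: "h n \<in> borel_measurable \<rho>" for n
      using borel_measurable_continuous_onI[OF hc] by (simp add: measurable_cong_sets[OF \<rho>(2) refl])
    have [measurable]: "C \<in> sets \<rho>" using C \<rho>(2) by simp
    have "(\<lambda>n. LINT z|\<rho>. h n z) \<longlonglongrightarrow> (LINT z|\<rho>. indicator C z)"
    proof (rule integral_dominated_convergence[where w = "\<lambda>_. 1"])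
      show "AE z in \<rho>. (\<lambda>n. h n z) \<longlonglongrightarrow> indicator C z"
      proof (rule AE_I2)
        fix z
        show "(\<lambda>n. h n z) \<longlonglongrightarrow> indicator C z"
        proof (cases "z \<in> C")
          case True
          then show ?thesis by (simp add: h_def)
        next
          case False
          then have d: "infdist z C > 0"
            using C \<open>C \<noteq> {}\<close> infdist_pos_not_in_closed by blast
          obtain N where N: "1 \<le> real N * infdist z C"
            using reals_Archimedean3[OF d] by (metis less_imp_le)
          have "h n z = 0" if "n \<ge> N" for n
          proof -
            have "real N * infdist z C \<le> real n * infdist z C"
              using d that by simp
            with N show ?thesis by (simp add: h_def)
          qed
          then show ?thesis
            using False by (intro tendsto_eventually) (auto simp: eventually_sequentially)
        qed
      qed
    qed (use h01 in auto)
    then show ?thesis by simp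
  qed
  have "measure \<nu> C = measure \<mu> C"
  \<comment> \<open>By convention \<open>infdist z {}\<close> is 0, so the approximants of the empty
    set would be constantly 1.\<close>
  proof (cases "C = {}")
    case False
    have "(LINT z|\<nu>. h n z) = (LINT z|\<mu>. h n z)" for n
      using h01 by (intro eq hc) (simp add: abs_le_iff)
    with lim[OF pr(1) st(1) False] lim[OF pr(2) st(2) False] show ?thesis
      using LIMSEQ_unique by simp
  qed simp
  then show "emeasure \<nu> C = emeasure \<mu> C"
    using pr by (simp add: finite_measure.emeasure_eq_measure prob_space.finite_measure)
qed auto

text \<open>The approximation is uniform on E only. That suffices because both measures are carried
  by E.\<close>

lemma chordal_moments_determine_measure:
  assumes E: "compact E" and \<nu>: "\<nu> \<in> prob_measures_on E" and \<mu>: "\<mu> \<in> prob_measures_on E"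
    and mom: "\<And>k i j. i \<le> k \<Longrightarrow> j \<le> k \<Longrightarrow> chordal_moment \<nu> k i j = chordal_moment \<mu> k i j"
  shows "\<nu> = \<mu>"
proof (rule measure_eqI_continuous_integrals)
  note pr = prob_measures_onD(1)[OF \<nu>] prob_measures_onD(1)[OF \<mu>]
  note st = prob_measures_onD(2)[OF \<nu>] prob_measures_onD(2)[OF \<mu>]
  show "prob_space \<nu>" "prob_space \<mu>" "sets \<nu> = sets borel" "sets \<mu> = sets borel"
    by (fact pr st)+
  fix f :: "complex \<Rightarrow> real"
  assume f: "continuous_on UNIV f" and bd: "\<And>x. \<bar>f x\<bar> \<le> 1"
  interpret R: function_ring_on "{f. (\<lambda>z. complex_of_real (f z)) \<in> chordal_span}" E
    by (rule chordal_function_ring[OF E])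
  have close: "\<bar>(LINT z|\<rho>. f z) - (LINT z|\<rho>. g z)\<bar> \<le> e"
    if \<rho>: "\<rho> \<in> prob_measures_on E" and g: "\<forall>x\<in>E. \<bar>f x - g x\<bar> < e" and ig: "integrable \<rho> g" for \<rho> g e
  proof -
    interpret prob_space \<rho> by (rule prob_measures_onD[OF \<rho>])
    have "f \<in> borel_measurable \<rho>"
      using borel_measurable_continuous_onI[OF f]
      by (simp add: measurable_cong_sets[OF prob_measures_onD(2)[OF \<rho>] refl])
    then have if': "integrable \<rho> f"
      using bd by (intro integrable_const_bound[where B = 1]) auto
    have "AE z in \<rho>. \<bar>f z - g z\<bar> \<le> e"
      using prob_measures_onD(3)[OF \<rho>] g by (auto elim!: eventually_mono intro: less_imp_le)
    then have "(LINT z|\<rho>. \<bar>f z - g z\<bar>) \<le> e"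
      using if' ig by (intro integral_le_const) auto
    moreover have "\<bar>LINT z|\<rho>. f z - g z\<bar> \<le> (LINT z|\<rho>. \<bar>f z - g z\<bar>)"
      by (rule integral_abs_bound)
    ultimately show ?thesis
      using if' ig by simp
  qed
  have "\<bar>(LINT z|\<nu>. f z) - (LINT z|\<mu>. f z)\<bar> \<le> 2 * e" if "e > 0" for e
  proof -
    obtain g where g: "(\<lambda>z. complex_of_real (g z)) \<in> chordal_span" "\<forall>x\<in>E. \<bar>f x - g x\<bar> < e"
      using R.Stone_Weierstrass_basic[OF continuous_on_subset[OF f subset_UNIV] \<open>e > 0\<close>] by auto
    have "integrable \<nu> (\<lambda>z. complex_of_real (g z)) \<and> integrable \<mu> (\<lambda>z. complex_of_real (g z))
       \<and> (LINT z|\<nu>. complex_of_real (g z)) = (LINT z|\<mu>. complex_of_real (g z))"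
      by (rule chordal_span_integral_eq[OF pr st mom g(1)])
    then have "integrable \<nu> g" "integrable \<mu> g" "(LINT z|\<nu>. g z) = (LINT z|\<mu>. g z)"
      by (simp_all add: complex_of_real_integrable_eq)
    with close[OF \<nu> g(2)] close[OF \<mu> g(2)] show ?thesis by linarith
  qed
  \<comment> \<open>If the difference were nonzero, this choice of e would bound it by half of
    itself.\<close>
  from this[of "\<bar>(LINT z|\<nu>. f z) - (LINT z|\<mu>. f z)\<bar> / 4"]
  show "(LINT z|\<nu>. f z) = (LINT z|\<mu>. f z)" by fastforce
qed

text \<open>A converse to Frostman's theorem for potentials that are constant everywhere on E, with
  \<gamma> the Robin constant. The equality case of the comparison supplies the uniqueness demanded
  by \<open>THE\<close>.\<close>

theorem equilibrium_measure_of_constant_potential: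
  assumes E: "compact E" and \<mu>: "\<mu> \<in> prob_measures_on E"
    and atom: "\<And>z. z \<in> E \<Longrightarrow> AE w in \<mu>. w \<noteq> z"
    and int: "\<And>z. z \<in> E \<Longrightarrow> integrable \<mu> (\<lambda>w. ln (dist z w))"
    and pot: "\<And>z. z \<in> E \<Longrightarrow> (LINT w|\<mu>. ln (dist z w)) = - \<gamma>"
  shows "equilibrium_measure E = \<mu>" "log_capacity E = exp (- \<gamma>)"
proof -
  note comp = energy_comparison[OF compact_imp_bounded[OF E] _ \<mu> atom int pot]
  have "is_equilibrium_measure E \<mu>"
    using \<mu> comp by (simp add: is_equilibrium_measure_def)
  moreover have "\<nu> = \<mu>" if "is_equilibrium_measure E \<nu>" for \<nu>
  proof -
    have \<nu>: "\<nu> \<in> prob_measures_on E" and "log_energy \<nu> \<le> log_energy \<mu>"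
      using that \<mu> by (auto simp: is_equilibrium_measure_def)
    then have "log_energy \<nu> = ereal \<gamma>"
      using comp(1)[OF \<mu>] comp(2)[OF \<nu>] by auto
    then show ?thesis
      using comp(3)[OF \<nu>] by (intro chordal_moments_determine_measure[OF E \<nu> \<mu>]) auto
  qed
  ultimately show "equilibrium_measure E = \<mu>"
    unfolding equilibrium_measure_def by (rule the_equality)
  have "min_log_energy E = ereal \<gamma>"
    unfolding min_log_energy_def
    by (rule antisym[OF INF_lower2[OF \<mu>] INF_greatest]) (simp_all add: comp(1)[OF \<mu>] comp(2))
  then show "log_capacity E = exp (- \<gamma>)"
    by (simp add: log_capacity_def)
qed

section \<open>Integrals of powers and logarithms of the sine\<close>

lemma set_integrable_affine:
  fixes f :: "real \<Rightarrow> 'a :: {banach, second_countable_topology}"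
  assumes "c \<noteq> 0" "set_integrable lborel S f"
  shows "set_integrable lborel {x. t + c * x \<in> S} (\<lambda>x. f (t + c * x))"
    and "(LINT x:S|lborel. f x) = \<bar>c\<bar> *\<^sub>R (LINT x:{x. t + c * x \<in> S}|lborel. f (t + c * x))"
proof -
  have ind: "indicator {x. t + c * x \<in> S} x = (indicator S (t + c * x) :: real)" for x
    by (simp add: indicator_def)
  show "set_integrable lborel {x. t + c * x \<in> S} (\<lambda>x. f (t + c * x))"
    using lborel_integrable_real_affine[OF assms(2)[unfolded set_integrable_def] assms(1), of t]
    by (simp add: set_integrable_def ind)
  show "(LINT x:S|lborel. f x) = \<bar>c\<bar> *\<^sub>R (LINT x:{x. t + c * x \<in> S}|lborel. f (t + c * x))"
    unfolding set_lebesgue_integral_def ind by (rule lborel_integral_real_affine[OF assms(1)])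
qed

text \<open>For p > -1 this is the mean of (2 sin x)^p over [0, pi/2], evaluated as a Beta
  function.\<close>

definition sin_moment :: "real \<Rightarrow> real" where
  "sin_moment p = 2 powr p * Gamma ((p + 1) / 2) / (sqrt pi * Gamma (p / 2 + 1))"

text \<open>The substitution t = sin^2 x in the Beta integral: the derivative 2 sin x cos x cancels
  the power of cos x and raises that of sin x to p. The endpoints are discarded because the
  cancellation divides by sin x and cos x.\<close>

lemma nn_integral_sin_powr:
  assumes "p > -1"
  shows "(\<integral>\<^sup>+ x. ennreal (2 * sin x powr p) * indicator {0..pi/2} x \<partial>lborel) = ennreal (Beta ((p + 1) / 2) (1/2))"
proof -
  define f :: "real \<Rightarrow> real" where "f = (\<lambda>t. t powr ((p + 1) / 2 - 1) * (1 - t) powr (1/2 - 1))"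
  have fm: "f \<in> borel_measurable borel"
    unfolding f_def by measurable
  have "((\<lambda>t. f t) has_integral Beta ((p + 1) / 2) (1/2)) {0..1}"
    unfolding f_def using assms by (intro has_integral_Beta_real) auto
  then have "ennreal (Beta ((p + 1) / 2) (1/2)) = (\<integral>\<^sup>+ x. ennreal (f x) * indicator {0..1} x \<partial>lborel)"
    by (intro nn_integral_has_integral_lebesgue'[symmetric]) (simp_all add: f_def)
  also have "\<dots> = (\<integral>\<^sup>+ x. ennreal (f x * indicator {(sin 0)\<^sup>2..(sin (pi/2))\<^sup>2} x) \<partial>lborel)"
    by (intro nn_integral_cong) (simp add: indicator_def)
  also have "\<dots> = (\<integral>\<^sup>+ x. ennreal (f ((sin x)\<^sup>2) * (2 * sin x * cos x) * indicator {0..pi/2} x) \<partial>lborel)"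
  proof (rule nn_integral_substitution)
    show "set_borel_measurable borel {(sin 0)\<^sup>2..(sin (pi/2))\<^sup>2} f"
      unfolding set_borel_measurable_def using fm by measurable
    show "((\<lambda>x. (sin x)\<^sup>2) has_real_derivative 2 * sin x * cos x) (at x)" for x :: real
      by (auto intro!: derivative_eq_intros)
    show "continuous_on {0..pi/2} (\<lambda>x. 2 * sin x * cos x)"
      by (intro continuous_intros)
    show "0 \<le> 2 * sin x * cos x" if "x \<in> {0..pi/2}" for x :: real
      using that by (intro mult_nonneg_nonneg sin_ge_zero cos_ge_zero) auto
  qed auto
  also have "\<dots> = (\<integral>\<^sup>+ x. ennreal (2 * sin x powr p) * indicator {0..pi/2} x \<partial>lborel)"
  proof (rule nn_integral_cong_AE)
    show "AE x in lborel. ennreal (f ((sin x)\<^sup>2) * (2 * sin x * cos x) * indicator {0..pi/2} x)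
        = ennreal (2 * sin x powr p) * indicator {0..pi/2} x"
      using AE_lborel_singleton[of 0] AE_lborel_singleton[of "pi/2"]
    proof eventually_elim
      case (elim x)
      show ?case
      proof (cases "x \<in> {0..pi/2}")
        case True
        with elim have x: "0 < x" "x < pi / 2" by auto
        then have s: "sin x > 0" and c: "cos x > 0"
          by (auto intro!: sin_gt_zero cos_gt_zero)
        have "(1 - (sin x)\<^sup>2) powr (1/2 - 1) = (cos x powr 2) powr (1/2 - 1)"
          using c by (simp add: cos_squared_eq[symmetric])
        also have "\<dots> = cos x powr (-1)"
          unfolding powr_powr by simp
        also have "\<dots> = 1 / cos x"
          using c by (simp add: powr_minus_divide)
        finally have f1: "(1 - (sin x)\<^sup>2) powr (1/2 - 1) = 1 / cos x" .
        have "(sin x)\<^sup>2 powr ((p + 1) / 2 - 1) = (sin x powr 2) powr ((p + 1) / 2 - 1)"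
          using s by simp
        also have "\<dots> = sin x powr (p - 1)"
          unfolding powr_powr by (rule arg_cong[of _ _ "(powr) (sin x)"]) simp
        also have "\<dots> = sin x powr p / sin x"
          using s by (simp add: powr_diff)
        finally have f2: "(sin x)\<^sup>2 powr ((p + 1) / 2 - 1) = sin x powr p / sin x" .
        have "f ((sin x)\<^sup>2) * (2 * sin x * cos x) = 2 * sin x powr p"
          unfolding f_def f1 f2 using s c by simp
        with True show ?thesis by (simp only: indicator_simps mult_1_right)
      qed simp
    qed
  qed
  finally show ?thesis by simp
qed

lemma sin_powr_integral:
  assumes "p > -1"
  shows "set_integrable lborel {0..pi/2} (\<lambda>x. (2 * sin x) powr p)"
    and "(LINT x:{0..pi/2}|lborel. (2 * sin x) powr p) = pi / 2 * sin_moment p"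
proof -
  let ?f = "\<lambda>x. 2 * sin x powr p * indicator {0..pi/2} x"
  have B: "Beta ((p + 1) / 2) (1/2) \<ge> 0"
  proof -
    have "(p + 1) / 2 + 1 / 2 > 0" using assms by (simp add: field_simps)
    then show ?thesis
      unfolding Beta_def using assms by (intro divide_nonneg_nonneg mult_nonneg_nonneg Gamma_real_nonneg) auto
  qed
  have "has_bochner_integral lborel ?f (Beta ((p + 1) / 2) (1/2))"
  proof (rule has_bochner_integral_nn_integral)
    have "(\<integral>\<^sup>+ x. ennreal (2 * sin x powr p * indicator {0..pi/2} x) \<partial>lborel)
       = (\<integral>\<^sup>+ x. ennreal (2 * sin x powr p) * indicator {0..pi/2} x \<partial>lborel)"
      by (intro nn_integral_cong) (simp add: indicator_def)
    then show "(\<integral>\<^sup>+ x. ennreal (2 * sin x powr p * indicator {0..pi/2} x) \<partial>lborel) = ennreal (Beta ((p + 1) / 2) (1/2))"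
      using nn_integral_sin_powr[OF assms] by simp
  qed (use B in auto)
  then have "has_bochner_integral lborel (\<lambda>x. 2 powr p / 2 * ?f x) (2 powr p / 2 * Beta ((p + 1) / 2) (1/2))"
    by (rule has_bochner_integral_mult_right)
  moreover have "2 powr p / 2 * ?f x = indicator {0..pi/2} x *\<^sub>R (2 * sin x) powr p" for x
    by (cases "x \<in> {0..pi/2}") (auto simp: powr_mult sin_ge_zero)
  moreover have "2 powr p / 2 * Beta ((p + 1) / 2) (1/2) = pi / 2 * sin_moment p"
  proof -
    have "(p + 1) / 2 + 1 / 2 = p / 2 + 1" by (simp add: field_simps)
    then have "2 powr p / 2 * Beta ((p + 1) / 2) (1/2) = 2 powr p / 2 * (Gamma ((p + 1) / 2) * sqrt pi / Gamma (p / 2 + 1))"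
      by (simp add: Beta_def Gamma_one_half_real)
    moreover have "a / 2 * (X * r / Y) = (r * r) / 2 * (a * X / (r * Y))" if "r > 0" for a X Y r :: real
      using that by (cases "Y = 0") auto
    from this[of "sqrt pi"]
    have "2 powr p / 2 * (Gamma ((p + 1) / 2) * sqrt pi / Gamma (p / 2 + 1))
       = (sqrt pi * sqrt pi) / 2 * (2 powr p * Gamma ((p + 1) / 2) / (sqrt pi * Gamma (p / 2 + 1)))"
      by simp
    ultimately show ?thesis
      unfolding sin_moment_def by simp
  qed
  ultimately have "has_bochner_integral lborel (\<lambda>x. indicator {0..pi/2} x *\<^sub>R (2 * sin x) powr p) (pi / 2 * sin_moment p)"
    by (simp only:)
  then show "set_integrable lborel {0..pi/2} (\<lambda>x. (2 * sin x) powr p)"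
     "(LINT x:{0..pi/2}|lborel. (2 * sin x) powr p) = pi / 2 * sin_moment p"
    by (simp_all add: set_integrable_def set_lebesgue_integral_def has_bochner_integral_iff)
qed

section \<open>The logarithmic sine integral over shifted intervals\<close>

definition log_sin :: "real \<Rightarrow> real" where
  "log_sin x = ln \<bar>2 * sin x\<bar>"

lemma borel_measurable_log_sin [measurable]: "log_sin \<in> borel_measurable borel"
  unfolding log_sin_def[abs_def] by measurable

lemma log_sin_minus: "log_sin (- x) = log_sin x"
  by (simp add: log_sin_def)

lemma log_sin_pi_minus: "log_sin (pi - x) = log_sin x"
  by (simp add: log_sin_def)

lemma log_sin_plus_pi: "log_sin (pi + x) = log_sin x"
  by (simp add: log_sin_def sin_add)

text \<open>Dominated through \<open>- ln x \<le> 2 x^(- 1/2)\<close>.\<close>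

lemma log_sin_integrable_quarter: "set_integrable lborel {0..pi/2} log_sin"
  unfolding set_integrable_def
proof (rule Bochner_Integration.integrable_bound)
  have i: "set_integrable lborel {0..pi/2} (\<lambda>x::real. ln 2)"
    using borel_integrable_atLeastAtMost'[of 0 "pi/2" "\<lambda>_. ln 2"] by simp
  have j: "set_integrable lborel {0..pi/2} (\<lambda>x. 2 * 2 powr (1/2) * (2 * sin x) powr (-1/2))"
    by (intro set_integrable_mult_right sin_powr_integral) simp
  show "integrable lborel (\<lambda>x. indicator {0..pi/2} x *\<^sub>R (ln 2 + 2 * 2 powr (1/2) * (2 * sin x) powr (-1/2)))"
    using set_integral_add(1)[OF i j] by (simp add: set_integrable_def)
  show "AE x in lborel. norm (indicator {0..pi/2} x *\<^sub>R log_sin x) \<le>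
      norm (indicator {0..pi/2} x *\<^sub>R (ln 2 + 2 * 2 powr (1/2) * (2 * sin x) powr (-1/2)))"
  proof (rule AE_I2)
    fix x :: real
    show "norm (indicator {0..pi/2} x *\<^sub>R log_sin x) \<le>
      norm (indicator {0..pi/2} x *\<^sub>R (ln 2 + 2 * 2 powr (1/2) * (2 * sin x) powr (-1/2)))"
    proof (cases "x \<in> {0..pi/2}")
      case True
      then have s: "0 \<le> sin x" by (auto intro!: sin_ge_zero)
      have "\<bar>log_sin x\<bar> \<le> ln 2 + 2 * sin x powr (-1/2)"
      proof (cases "sin x = 0")
        case False
        with s have s: "sin x > 0" by simp
        have "ln (sin x powr (-1/2)) \<le> sin x powr (-1/2) - 1"
          using s by (intro ln_le_minus_one) simp
        then have "- ln (sin x) \<le> 2 * sin x powr (-1/2)"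
          using s by (simp add: ln_powr)
        moreover have "log_sin x = ln 2 + ln (sin x)"
          using s by (simp add: log_sin_def ln_mult)
        moreover have "ln (sin x) \<le> 0"
          using s by simp
        moreover have "ln 2 \<ge> (0::real)" by simp
        ultimately show ?thesis by linarith
      qed (simp add: log_sin_def)
      also have "2 * sin x powr (-1/2) = 2 * 2 powr (1/2) * (2 * sin x) powr (-1/2)"
        using s by (simp add: powr_mult powr_minus field_simps)
      finally show ?thesis using True by simp
    qed simp
  qed
qed auto

lemma log_sin_integral_reflect:
  "set_integrable lborel {-pi/2..0} log_sin"
  "(LINT x:{-pi/2..0}|lborel. log_sin x) = (LINT x:{0..pi/2}|lborel. log_sin x)"
  "set_integrable lborel {pi/2..pi} log_sin"
  "(LINT x:{pi/2..pi}|lborel. log_sin x) = (LINT x:{0..pi/2}|lborel. log_sin x)"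
proof -
  have e1: "{x. 0 + (-1) * x \<in> {0..pi/2}} = {-pi/2..0}"
    and e2: "{x. pi + (-1) * x \<in> {0..pi/2}} = {pi/2..pi}"
    by auto
  note q = log_sin_integrable_quarter
  show "set_integrable lborel {-pi/2..0} log_sin"
    using set_integrable_affine(1)[OF _ q, of "-1" 0, unfolded e1] by (simp add: log_sin_minus)
  show "(LINT x:{-pi/2..0}|lborel. log_sin x) = (LINT x:{0..pi/2}|lborel. log_sin x)"
    using set_integrable_affine(2)[OF _ q, of "-1" 0, unfolded e1] by (simp add: log_sin_minus)
  show "set_integrable lborel {pi/2..pi} log_sin"
    using set_integrable_affine(1)[OF _ q, of "-1" pi, unfolded e2] by (simp add: log_sin_pi_minus)
  show "(LINT x:{pi/2..pi}|lborel. log_sin x) = (LINT x:{0..pi/2}|lborel. log_sin x)"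
    using set_integrable_affine(2)[OF _ q, of "-1" pi, unfolded e2] by (simp add: log_sin_pi_minus)
qed

lemma set_integral_Icc_split:
  fixes f :: "real \<Rightarrow> real"
  assumes "set_integrable lborel {a..c} f" "a \<le> b" "b \<le> c"
  shows "(LINT x:{a..c}|lborel. f x) = (LINT x:{a..b}|lborel. f x) + (LINT x:{b..c}|lborel. f x)"
proof -
  have i: "set_integrable lborel {a..b} f" "set_integrable lborel {b<..c} f" "set_integrable lborel {b..c} f"
    using assms by (auto intro: set_integrable_subset)
  have "{a..c} = {a..b} \<union> {b<..c}" using assms by auto
  then have "(LINT x:{a..c}|lborel. f x) = (LINT x:{a..b}|lborel. f x) + (LINT x:{b<..c}|lborel. f x)"
    using i by (simp only:) (intro set_integral_Un; auto)
  also have "(LINT x:{b<..c}|lborel. f x) = (LINT x:{b..c}|lborel. f x)"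
    unfolding set_lebesgue_integral_def
  proof (rule integral_cong_AE)
    show "AE x in lborel. indicator {b<..c} x *\<^sub>R f x = indicator {b..c} x *\<^sub>R f x"
      using AE_lborel_singleton[of b] by eventually_elim (auto simp: indicator_def)
  qed (use i in \<open>auto simp: set_integrable_def\<close>)
  finally show ?thesis .
qed

text \<open>The interval is the range of \<theta> + \<phi> and \<theta> - \<phi> together, for
  \<theta> and \<phi> in [0, pi/2].\<close>

lemma log_sin_integrable: "set_integrable lborel {-pi/2..pi} log_sin"
proof -
  have "{-pi/2..pi} = {-pi/2..0} \<union> ({0..pi/2} \<union> {pi/2..pi})" by auto
  then show ?thesis
    using log_sin_integrable_quarter log_sin_integral_reflect
    by (simp only:) (intro set_integrable_Un; auto)
qed

text \<open>By \<open>2 sin 2x = (2 sin x) (2 sin (\<pi>/2 - x))\<close> the integral equals twice itself.\<close>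

lemma log_sin_integral_zero: "(LINT x:{0..pi/2}|lborel. log_sin x) = 0"
proof -
  let ?I = "LINT x:{0..pi/2}|lborel. log_sin x"
  have i: "set_integrable lborel {0..pi} log_sin"
    by (rule set_integrable_subset[OF log_sin_integrable]) auto
  have "(LINT x:{0..pi}|lborel. log_sin x) = 2 * ?I"
    using set_integral_Icc_split[OF i, of "pi/2"] log_sin_integral_reflect(4) by simp
  moreover have e: "{x. 0 + 2 * x \<in> {0..pi}} = {0..pi/2}" by auto
  ultimately have I: "(LINT x:{0..pi/2}|lborel. log_sin (2 * x)) = ?I"
    using set_integrable_affine(2)[OF _ i, of 2 0, unfolded e] by simp
  have e2: "{x. pi/2 + (-1) * x \<in> {0..pi/2}} = {0..pi/2}" by auto
  have r: "set_integrable lborel {0..pi/2} (\<lambda>x. log_sin (pi/2 - x))"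
      "(LINT x:{0..pi/2}|lborel. log_sin (pi/2 - x)) = ?I"
    using set_integrable_affine[OF _ log_sin_integrable_quarter, of "-1" "pi/2", unfolded e2] by simp_all
  have "(LINT x:{0..pi/2}|lborel. log_sin (2 * x)) = (LINT x:{0..pi/2}|lborel. log_sin x + log_sin (pi/2 - x))"
    unfolding set_lebesgue_integral_def
  proof (rule integral_cong_AE)
    show "AE x in lborel. indicator {0..pi/2} x *\<^sub>R log_sin (2 * x) =
        indicator {0..pi/2} x *\<^sub>R (log_sin x + log_sin (pi/2 - x))"
      using AE_lborel_singleton[of 0] AE_lborel_singleton[of "pi/2"]
    proof eventually_elim
      case (elim x)
      show ?case
      proof (cases "x \<in> {0..pi/2}")
        case True
        with elim have x: "0 < x" "x < pi / 2" by auto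
        then have s: "sin x > 0" and c: "cos x > 0"
          by (auto intro!: sin_gt_zero cos_gt_zero)
        have "\<bar>2 * sin (2 * x)\<bar> = (2 * sin x) * (2 * cos x)"
          using s c by (simp add: sin_double)
        then have "log_sin (2 * x) = ln (2 * sin x) + ln (2 * cos x)"
          unfolding log_sin_def using s c by (metis ln_mult_pos mult_pos_pos zero_less_numeral)
        then show ?thesis
          using s c by (simp add: log_sin_def sin_diff)
      qed simp
    qed
  qed auto
  also have "\<dots> = ?I + ?I"
    using set_integral_add(2)[OF log_sin_integrable_quarter r(1)] r(2) by simp
  finally show ?thesis using I by simp
qed

text \<open>The two summands integrate \<open>log_sin\<close> over the adjacent intervals
  [t, t + pi/2] and [t - pi/2, t]. Together these make a full period of length pi, over which the
  integral is 0 wherever the period starts.\<close>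

lemma log_sin_convolution:
  assumes "0 \<le> t" "t \<le> pi / 2"
  shows "set_integrable lborel {0..pi/2} (\<lambda>x. log_sin (t + x) + log_sin (t - x))"
    and "(LINT x:{0..pi/2}|lborel. log_sin (t + x) + log_sin (t - x)) = 0"
proof -
  have sub: "set_integrable lborel {a..b} log_sin" if "-pi/2 \<le> a" "b \<le> pi" for a b
    using that by (intro set_integrable_subset[OF log_sin_integrable]) auto
  have e1: "{x. t + 1 * x \<in> {t..t+pi/2}} = {0..pi/2}"
    and e2: "{x. t + (-1) * x \<in> {t-pi/2..t}} = {0..pi/2}"
    and e3: "{x. pi + 1 * x \<in> {pi/2..t+pi/2}} = {-pi/2..t-pi/2}"
    by auto
  have i1: "set_integrable lborel {t..t+pi/2} log_sin"
   and i2: "set_integrable lborel {t-pi/2..t} log_sin"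
   and i3: "set_integrable lborel {pi/2..t+pi/2} log_sin"
    using assms by (auto intro!: sub)
  have 1: "set_integrable lborel {0..pi/2} (\<lambda>x. log_sin (t + x))"
      "(LINT x:{0..pi/2}|lborel. log_sin (t + x)) = (LINT x:{t..t+pi/2}|lborel. log_sin x)"
    using set_integrable_affine[OF _ i1, of 1 t, unfolded e1] by simp_all
  have 2: "set_integrable lborel {0..pi/2} (\<lambda>x. log_sin (t - x))"
      "(LINT x:{0..pi/2}|lborel. log_sin (t - x)) = (LINT x:{t-pi/2..t}|lborel. log_sin x)"
    using set_integrable_affine[OF _ i2, of "-1" t, unfolded e2] by simp_all
  show "set_integrable lborel {0..pi/2} (\<lambda>x. log_sin (t + x) + log_sin (t - x))"
    using 1 2 by (intro set_integral_add)
  have "(LINT x:{0..pi/2}|lborel. log_sin (t + x) + log_sin (t - x))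
     = (LINT x:{t-pi/2..t}|lborel. log_sin x) + (LINT x:{t..t+pi/2}|lborel. log_sin x)"
    using set_integral_add(2)[OF 1(1) 2(1)] 1(2) 2(2) by simp
  also have "\<dots> = (LINT x:{t-pi/2..t+pi/2}|lborel. log_sin x)"
    using assms by (intro set_integral_Icc_split[symmetric] sub) auto
  also have "\<dots> = (LINT x:{t-pi/2..pi/2}|lborel. log_sin x) + (LINT x:{pi/2..t+pi/2}|lborel. log_sin x)"
    using assms by (intro set_integral_Icc_split sub) auto
  \<comment> \<open>The part beyond pi/2 is moved back by one period, where it completes the
    interval [-pi/2, pi/2].\<close>
  also have "(LINT x:{pi/2..t+pi/2}|lborel. log_sin x) = (LINT x:{-pi/2..t-pi/2}|lborel. log_sin x)"
    using set_integrable_affine(2)[OF _ i3, of 1 pi, unfolded e3] by (simp add: log_sin_plus_pi)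
  also have "(LINT x:{t-pi/2..pi/2}|lborel. log_sin x) + (LINT x:{-pi/2..t-pi/2}|lborel. log_sin x)
      = (LINT x:{-pi/2..pi/2}|lborel. log_sin x)"
    using assms set_integral_Icc_split[OF sub[of "-pi/2" "pi/2"], of "t - pi/2"] by simp
  also have "\<dots> = 0"
    using set_integral_Icc_split[OF sub[of "-pi/2" "pi/2"], of 0] log_sin_integral_zero log_sin_integral_reflect(2)
    by simp
  finally show "(LINT x:{0..pi/2}|lborel. log_sin (t + x) + log_sin (t - x)) = 0" .
qed

section \<open>The equilibrium measure of the star\<close>

text \<open>As z^m may have either sign, the star has 2m rays from 0, in the directions of the 2m-th
  roots of unity; on the j-th of them z^m has sign (-1)^j. For uniform \<phi> and a random ray, z^m
  follows the arcsine law, the equilibrium measure of [-2, 2].\<close>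

definition star_point :: "nat \<Rightarrow> nat \<Rightarrow> real \<Rightarrow> complex" where
  "star_point m j \<phi> = cis (2 * pi * real j / real (2 * m)) * of_real ((2 * sin \<phi>) powr (1 / real m))"

definition quarter_arc :: "real measure" where
  "quarter_arc = density lborel (\<lambda>\<phi>. ennreal (2 / pi * indicator {0..pi/2} \<phi>))"

text \<open>A random point \<open>z\<close> of this measure has an equidistributed ray among the \<open>2m\<close> rays of the star,
  and \<open>|z|^m = 2 sin \<phi>\<close> with \<open>\<phi>\<close> uniform on \<open>[0, \<pi>/2]\<close>.\<close>

definition star_measure :: "nat \<Rightarrow> complex measure" where
  "star_measure m = distr (measure_pmf (pmf_of_set {..<2 * m}) \<Otimes>\<^sub>M quarter_arc) borel
     (\<lambda>p. star_point m (fst p) (snd p))"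

lemma prob_space_quarter_arc: "prob_space quarter_arc"
proof (rule prob_spaceI)
  have "emeasure quarter_arc (space quarter_arc)
     = (\<integral>\<^sup>+ x. ennreal (2 / pi) * indicator {0..pi/2} x \<partial>lborel)"
    unfolding quarter_arc_def
    by (subst emeasure_density) (auto intro!: nn_integral_cong simp: indicator_def)
  also have "\<dots> = ennreal (2 / pi) * ennreal (pi / 2)"
    by (simp add: nn_integral_cmult)
  also have "\<dots> = 1"
    by (simp flip: ennreal_mult)
  finally show "emeasure quarter_arc (space quarter_arc) = 1" .
qed

lemma sets_quarter_arc [measurable_cong]: "sets quarter_arc = sets borel"
  by (simp add: quarter_arc_def)

lemma AE_quarter_arc: "AE \<phi> in lborel. \<phi> \<in> {0..pi/2} \<longrightarrow> P \<phi> \<Longrightarrow> AE \<phi> in quarter_arc. P \<phi>"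
  unfolding quarter_arc_def
  by (subst AE_density) (auto elim!: eventually_mono simp: indicator_def split: if_splits)

lemma borel_measurable_star_point [measurable]: "star_point m j \<in> borel_measurable borel"
proof -
  have "(\<lambda>\<phi>. complex_of_real ((2 * sin \<phi>) powr (1 / real m))) \<in> borel_measurable borel"
    by measurable
  then show ?thesis
    unfolding star_point_def[abs_def] by measurable
qed

lemma integral_quarter_arc:
  fixes f :: "real \<Rightarrow> 'b :: {banach, second_countable_topology}"
  assumes "f \<in> borel_measurable borel"
  shows "integrable quarter_arc f \<longleftrightarrow> set_integrable lborel {0..pi/2} f"
    "(LINT \<phi>|quarter_arc. f \<phi>) = (2 / pi) *\<^sub>R (LINT \<phi>:{0..pi/2}|lborel. f \<phi>)"
proof -
  have f: "f \<in> borel_measurable lborel" using assms by simp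
  have *: "(2 / pi * indicator {0..pi/2} \<phi>) *\<^sub>R f \<phi> = (2 / pi) *\<^sub>R (indicator {0..pi/2} \<phi> *\<^sub>R f \<phi>)" for \<phi>
    by simp
  show "integrable quarter_arc f \<longleftrightarrow> set_integrable lborel {0..pi/2} f"
  proof -
    let ?g = "\<lambda>\<phi>. indicator {0..pi/2} \<phi> *\<^sub>R f \<phi>"
    have "integrable quarter_arc f \<longleftrightarrow> integrable lborel (\<lambda>\<phi>. (2 / pi) *\<^sub>R ?g \<phi>)"
      unfolding quarter_arc_def by (subst integrable_density[OF f]) (simp_all only: *, auto)
    also have "\<dots> \<longleftrightarrow> integrable lborel ?g"
      using integrable_scaleR_right[of "pi / 2" lborel "\<lambda>\<phi>. (2 / pi) *\<^sub>R ?g \<phi>"]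
        integrable_scaleR_right[of "2 / pi" lborel ?g] by auto
    finally show ?thesis by (simp add: set_integrable_def)
  qed
  show "(LINT \<phi>|quarter_arc. f \<phi>) = (2 / pi) *\<^sub>R (LINT \<phi>:{0..pi/2}|lborel. f \<phi>)"
    unfolding quarter_arc_def set_lebesgue_integral_def
    by (subst integral_density[OF f]) (simp_all only: * integral_scaleR_right, auto)
qed

context
  fixes m :: nat
  assumes m: "m > 0"
begin

lemma star_point_measurable_pair:
  "(\<lambda>p. star_point m (fst p) (snd p)) \<in> borel_measurable (measure_pmf (pmf_of_set {..<2 * m}) \<Otimes>\<^sub>M quarter_arc)"
proof -
  have 1: "(\<lambda>p. cis (2 * pi * real (fst p) / real (2 * m))) \<in> borel_measurable (measure_pmf (pmf_of_set {..<2 * m}) \<Otimes>\<^sub>M quarter_arc)"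
    by (rule measurable_compose[OF measurable_fst]) simp
  have 2: "(\<lambda>p. complex_of_real ((2 * sin (snd p)) powr (1 / real m))) \<in> borel_measurable (measure_pmf (pmf_of_set {..<2 * m}) \<Otimes>\<^sub>M quarter_arc)"
    by measurable
  show ?thesis
    unfolding star_point_def[abs_def] by (rule borel_measurable_times[OF 1 2])
qed

lemma prob_space_star_measure: "prob_space (star_measure m)"
proof -
  interpret Q: prob_space quarter_arc by (rule prob_space_quarter_arc)
  interpret P: pair_prob_space "measure_pmf (pmf_of_set {..<2 * m})" quarter_arc ..
  show ?thesis
    unfolding star_measure_def by (rule P.prob_space_distr[OF star_point_measurable_pair])
qed

lemma sets_star_measure: "sets (star_measure m) = sets borel"
  by (simp add: star_measure_def)

lemma set_pmf_star: "set_pmf (pmf_of_set {..<2 * m}) = {..<2 * m}"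
  using m by (intro set_pmf_of_set) (auto simp: lessThan_empty_iff)

lemma star_measure_integral:
  fixes f :: "complex \<Rightarrow> 'b :: {banach, second_countable_topology}"
  assumes f: "f \<in> borel_measurable borel"
    and i: "\<And>j. j < 2 * m \<Longrightarrow> set_integrable lborel {0..pi/2} (\<lambda>\<phi>. f (star_point m j \<phi>))"
  shows "integrable (star_measure m) f"
    "(LINT z|star_measure m. f z) = (1 / real (2 * m)) *\<^sub>R
       (\<Sum>j<2*m. (2 / pi) *\<^sub>R (LINT \<phi>:{0..pi/2}|lborel. f (star_point m j \<phi>)))"
proof -
  interpret Q: prob_space quarter_arc by (rule prob_space_quarter_arc)
  interpret P: pair_prob_space "measure_pmf (pmf_of_set {..<2 * m})" quarter_arc ..
  let ?P = "measure_pmf (pmf_of_set {..<2 * m}) \<Otimes>\<^sub>M quarter_arc"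
  have fs: "(\<lambda>\<phi>. f (star_point m j \<phi>)) \<in> borel_measurable borel" for j
    by (rule measurable_compose[OF borel_measurable_star_point f])
  have fp: "(\<lambda>p. f (star_point m (fst p) (snd p))) \<in> borel_measurable ?P"
    by (rule measurable_compose[OF star_point_measurable_pair f])
  have ip: "integrable ?P (\<lambda>p. f (star_point m (fst p) (snd p)))"
  proof (rule P.Fubini_integrable[OF fp])
    show "integrable (measure_pmf (pmf_of_set {..<2 * m}))
        (\<lambda>x. LINT y|quarter_arc. norm (f (star_point m (fst (x, y)) (snd (x, y)))))"
      by (intro integrable_measure_pmf_finite) (simp add: set_pmf_star)
    show "AE x in measure_pmf (pmf_of_set {..<2 * m}). integrable quarter_arc
        (\<lambda>y. f (star_point m (fst (x, y)) (snd (x, y))))"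
      using i by (simp add: AE_measure_pmf_iff set_pmf_star integral_quarter_arc(1)[OF fs])
  qed
  show "integrable (star_measure m) f"
    unfolding star_measure_def using ip f star_point_measurable_pair by (simp add: integrable_distr_eq)
  have "(LINT z|star_measure m. f z) = (LINT p|?P. f (star_point m (fst p) (snd p)))"
    unfolding star_measure_def using f star_point_measurable_pair by (simp add: integral_distr)
  also have "\<dots> = (LINT j|measure_pmf (pmf_of_set {..<2 * m}). LINT \<phi>|quarter_arc. f (star_point m j \<phi>))"
    using P.integral_fst'[OF ip] by simp
  also have "\<dots> = (\<Sum>j<2*m. pmf (pmf_of_set {..<2 * m}) j *\<^sub>R (LINT \<phi>|quarter_arc. f (star_point m j \<phi>)))"
    by (intro integral_measure_pmf) (auto simp: set_pmf_star)
  also have "\<dots> = (1 / real (2 * m)) *\<^sub>R (\<Sum>j<2*m. LINT \<phi>|quarter_arc. f (star_point m j \<phi>))"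
    unfolding scaleR_sum_right using m
    by (intro sum.cong refl) (subst pmf_of_set, auto simp: lessThan_empty_iff)
  finally show "(LINT z|star_measure m. f z) = (1 / real (2 * m)) *\<^sub>R
       (\<Sum>j<2*m. (2 / pi) *\<^sub>R (LINT \<phi>:{0..pi/2}|lborel. f (star_point m j \<phi>)))"
    by (simp add: integral_quarter_arc(2)[OF fs])
qed

lemma star_point_power_m:
  assumes "\<phi> \<in> {0..pi/2}"
  shows "star_point m j \<phi> ^ m = (-1) ^ j * of_real (2 * sin \<phi>)"
proof -
  have s: "sin \<phi> \<ge> 0" using assms by (intro sin_ge_zero) auto
  have "cis (2 * pi * real j / real (2 * m)) ^ m = cis (real j * pi)"
    unfolding Complex.DeMoivre using m by (intro arg_cong[of _ _ cis]) simp
  also have "\<dots> = (-1) ^ j"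
    unfolding Complex.DeMoivre[symmetric] by simp
  finally have 1: "cis (2 * pi * real j / real (2 * m)) ^ m = (-1) ^ j" .
  have "((2 * sin \<phi>) powr (1 / real m)) ^ m = ((2 * sin \<phi>) powr (1 / real m)) powr real m" if "sin \<phi> \<noteq> 0"
    using that s by (intro powr_realpow[symmetric]) auto
  also have "\<dots> = 2 * sin \<phi>" if "sin \<phi> \<noteq> 0"
    using m s by (simp add: powr_powr)
  finally have 2: "((2 * sin \<phi>) powr (1 / real m)) ^ m = 2 * sin \<phi>"
    using m by (cases "sin \<phi> = 0") auto
  show ?thesis
    unfolding star_point_def power_mult_distrib 1 of_real_power[symmetric] 2 ..
qed

lemma star_point_in_star_set:
  assumes "\<phi> \<in> {0..pi/2}"
  shows "star_point m j \<phi> \<in> star_set m"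
proof -
  have "star_point m j \<phi> ^ m = complex_of_real ((-1) ^ j * (2 * sin \<phi>))"
    using star_point_power_m[OF assms] by simp
  moreover have "(-1) ^ j * (2 * sin \<phi>) \<in> {-2..2}"
  proof -
    have "sin \<phi> \<ge> 0" using assms by (intro sin_ge_zero) auto
    then show ?thesis
      using sin_le_one[of \<phi>] by (cases "even j") auto
  qed
  ultimately show ?thesis unfolding star_set_def by blast
qed

lemma AE_star_measure:
  assumes P: "Measurable.pred borel P"
    and "\<And>j. j < 2 * m \<Longrightarrow> AE \<phi> in lborel. \<phi> \<in> {0..pi/2} \<longrightarrow> P (star_point m j \<phi>)"
  shows "AE z in star_measure m. P z"
proof -
  interpret Q: prob_space quarter_arc by (rule prob_space_quarter_arc)
  interpret P: pair_prob_space "measure_pmf (pmf_of_set {..<2 * m})" quarter_arc ..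
  let ?P = "measure_pmf (pmf_of_set {..<2 * m}) \<Otimes>\<^sub>M quarter_arc"
  have "Measurable.pred ?P (\<lambda>p. P (star_point m (fst p) (snd p)))"
    by (rule measurable_compose[OF star_point_measurable_pair P])
  moreover have "AE j in measure_pmf (pmf_of_set {..<2 * m}). AE \<phi> in quarter_arc. P (star_point m j \<phi>)"
    using assms(2) by (auto simp: AE_measure_pmf_iff set_pmf_star intro!: AE_quarter_arc)
  ultimately have "AE p in ?P. P (star_point m (fst p) (snd p))"
    by (intro P.AE_pair_measure) (auto simp: pred_def)
  then show ?thesis
    unfolding star_measure_def using P
    by (subst AE_distr_iff[OF star_point_measurable_pair]) (auto simp: pred_def)
qed

lemma closed_star_set: "closed (star_set m)"
proof -
  have "closed (complex_of_real ` {-2..2})"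
    by (intro compact_imp_closed compact_continuous_image continuous_intros compact_Icc)
  then have "closed ((\<lambda>z. z ^ m) -` (complex_of_real ` {-2..2}))"
    by (intro closed_vimage continuous_intros)
  then show ?thesis by (simp add: star_set_def vimage_def)
qed

lemma norm_star_set:
  assumes "z \<in> star_set m"
  shows "cmod z \<le> 2"
proof -
  obtain x where x: "z ^ m = of_real x" "\<bar>x\<bar> \<le> 2"
    using assms by (auto simp: star_set_def abs_le_iff)
  then have "cmod z ^ m \<le> 2"
    by (metis norm_of_real norm_power)
  show ?thesis
  proof (rule ccontr)
    assume "\<not> cmod z \<le> 2"
    then have "cmod z > 2" by simp
    then have "cmod z ^ 1 \<le> cmod z ^ m" using m by (intro power_increasing) auto
    with \<open>cmod z > 2\<close> \<open>cmod z ^ m \<le> 2\<close> show False by simp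
  qed
qed

lemma compact_star_set: "compact (star_set m)"
  using closed_star_set norm_star_set by (auto simp: compact_eq_bounded_closed bounded_iff)

lemma star_measure_prob_measures_on: "star_measure m \<in> prob_measures_on (star_set m)"
proof -
  have "star_set m \<in> sets borel" using closed_star_set by (intro borel_closed)
  then have "AE z in star_measure m. z \<in> star_set m"
    by (intro AE_star_measure AE_I2) (auto intro: star_point_in_star_set)
  then show ?thesis
    by (simp add: prob_measures_on_def prob_space_star_measure sets_star_measure)
qed

lemma star_measure_no_atoms: "AE w in star_measure m. w \<noteq> z"
proof (rule AE_star_measure)
  show "Measurable.pred borel (\<lambda>w. w \<noteq> z)" by measurable
  fix j
  show "AE \<phi> in lborel. \<phi> \<in> {0..pi/2} \<longrightarrow> star_point m j \<phi> \<noteq> z"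
    \<comment> \<open>The only angle that can lead to z, because |z|^m = 2 sin \<phi> on every ray.
      If none does, removing this point is harmless.\<close>
    using AE_lborel_singleton[of "arcsin (cmod z ^ m / 2)"]
  proof eventually_elim
    case (elim \<phi>)
    show ?case
    proof (intro impI notI)
      assume \<phi>: "\<phi> \<in> {0..pi/2}" and "star_point m j \<phi> = z"
      then have "z ^ m = (-1) ^ j * of_real (2 * sin \<phi>)"
        using star_point_power_m by blast
      then have "cmod (z ^ m) = 2 * sin \<phi>"
        using \<phi> by (simp add: norm_power norm_mult sin_ge_zero)
      then have "cmod z ^ m = 2 * sin \<phi>"
        by (simp only: norm_power)
      then have "arcsin (cmod z ^ m / 2) = \<phi>"
        using \<phi> by (simp add: arcsin_sin)
      with elim show False by simp
    qed
  qed
qed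

end

section \<open>Products and sums over roots of unity, and the potential of the star\<close>

abbreviation unity_root :: "nat \<Rightarrow> nat \<Rightarrow> complex" where
  "unity_root n j \<equiv> cis (2 * pi * real j / real n)"

lemma unity_root_power: "n > 0 \<Longrightarrow> unity_root n j ^ n = 1"
  using Complex.bij_betw_roots_unity[of n] unfolding Complex.DeMoivre
  by (simp add: cis_multiple_2pi)

lemma unity_root_eq_power: "unity_root n j = unity_root n 1 ^ j"
  unfolding Complex.DeMoivre by (intro arg_cong[of _ _ cis]) simp

lemma inj_on_unity_root: "n > 0 \<Longrightarrow> inj_on (unity_root n) {..<n}"
  using Complex.bij_betw_roots_unity[of n] by (simp add: bij_betw_def)

text \<open>As polynomials in z both sides are monic of degree n and vanish at the n points
  \<open>unity_root n j * a\<close>. These are distinct only for nonzero a, so a = 0 is treated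
  separately.\<close>

lemma prod_diff_unity_roots:
  assumes n: "n > 0"
  shows "(\<Prod>j<n. z - unity_root n j * a) = z ^ n - a ^ n"
proof (cases "a = 0")
  case False
  let ?p = "\<Prod>j<n. [:- (unity_root n j * a), 1:]" and ?q = "monom 1 n - [:a ^ n:]"
  let ?A = "(\<lambda>j. unity_root n j * a) ` {..<n}"
  have card: "card ?A = n"
    using inj_on_unity_root[OF n] False by (subst card_image) (auto simp: inj_on_def)
  have deg: "degree ?p = n"
    by (subst degree_prod_eq_sum_degree) auto
  have "lead_coeff ?p = 1"
    unfolding lead_coeff_prod by simp
  then have "coeff ?p n = coeff ?q n"
    using n unfolding deg by (simp add: coeff_pCons split: nat.split)
  moreover have "degree ?q \<le> n"
    by (intro degree_diff_le) (auto simp: degree_monom_le)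
  moreover have "poly ?p x = poly ?q x" if x: "x \<in> ?A" for x
  proof -
    obtain j where j: "j < n" "x = unity_root n j * a" using x by blast
    then have "poly ?p x = 0" by (auto simp: poly_prod)
    moreover have "poly ?q x = 0"
      using unity_root_power[OF n] by (simp add: j poly_monom power_mult_distrib)
    ultimately show ?thesis by simp
  qed
  ultimately have "?p = ?q"
    using card deg by (intro poly_eqI_degree_lead_coeff[where A = ?A]) auto
  then have "poly ?p z = poly ?q z" by simp
  then show ?thesis by (simp add: poly_prod poly_monom)
qed (use n in simp)

text \<open>Orthogonality of the characters of Z/n. The summands are the powers of one n-th root of
  unity q, which is 1 exactly when the residues agree; otherwise the geometric sum vanishes.\<close>

lemma sum_unity_roots:
  assumes n: "n > 0"
  shows "(\<Sum>j<n. unity_root n j ^ a * cnj (unity_root n j) ^ b) = (if a mod n = b mod n then of_nat n else 0)"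
proof -
  let ?c = "unity_root n 1"
  define q where "q = ?c ^ a * cnj ?c ^ b"
  have c1: "?c * cnj ?c = 1"
    by (simp add: cis_cnj cis_mult)
  have red: "?c ^ k = unity_root n (k mod n)" for k
  proof -
    have "?c ^ k = (?c ^ n) ^ (k div n) * ?c ^ (k mod n)"
      by (simp flip: power_mult power_add)
    also have "\<dots> = ?c ^ (k mod n)"
      by (simp only: unity_root_power[OF n] power_one mult_1)
    also have "\<dots> = unity_root n (k mod n)"
      by (rule unity_root_eq_power[symmetric])
    finally show ?thesis .
  qed
  have "q * ?c ^ b = ?c ^ a * (?c * cnj ?c) ^ b"
    unfolding q_def power_mult_distrib by (simp only: ac_simps)
  then have "q * ?c ^ b = ?c ^ a"
    by (simp only: c1 power_one mult_1_right)
  moreover have "?c ^ b \<noteq> 0" by simp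
  ultimately have "q = 1 \<longleftrightarrow> ?c ^ a = ?c ^ b"
    by (metis mult_1 mult_cancel_right)
  also have "\<dots> \<longleftrightarrow> a mod n = b mod n"
    unfolding red using inj_on_unity_root[OF n] n by (auto simp: inj_on_def)
  finally have q1: "q = 1 \<longleftrightarrow> a mod n = b mod n" .
  have qn: "q ^ n = 1"
  proof -
    have "q ^ n = (?c ^ n) ^ a * cnj (?c ^ n) ^ b"
      unfolding q_def power_mult_distrib complex_cnj_power by (simp flip: power_mult add: mult.commute)
    then show ?thesis
      by (simp only: unity_root_power[OF n]) simp
  qed
  have "(\<Sum>j<n. unity_root n j ^ a * cnj (unity_root n j) ^ b) = (\<Sum>j<n. q ^ j)"
  proof (intro sum.cong refl)
    fix j
    have "unity_root n j ^ a * cnj (unity_root n j) ^ b = (?c ^ j) ^ a * cnj (?c ^ j) ^ b"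
      by (subst (1 2) unity_root_eq_power) (rule refl)
    also have "\<dots> = q ^ j"
      unfolding q_def power_mult_distrib complex_cnj_power by (simp flip: power_mult add: mult.commute)
    finally show "unity_root n j ^ a * cnj (unity_root n j) ^ b = q ^ j" .
  qed
  also have "\<dots> = (if q = 1 then of_nat n else 0)"
    using qn by (simp add: sum_gp_strict)
  finally show ?thesis using q1 by simp
qed

context
  fixes m :: nat
  assumes m: "m > 0"
begin

lemma star_point_power_2m:
  assumes "\<phi> \<in> {0..pi/2}"
  shows "star_point m j \<phi> ^ (2 * m) = of_real (4 * (sin \<phi>)\<^sup>2)"
  unfolding mult.commute[of 2 m] power_mult star_point_power_m[OF m assms]
  by (simp add: power_mult_distrib power_commutes flip: power_mult)

text \<open>Only z^(2m) enters the product of the distances to the rays, so the ray of z itself need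
  not be identified.\<close>

lemma star_set_param:
  assumes "z \<in> star_set m"
  obtains \<theta> where "\<theta> \<in> {0..pi/2}" "z ^ (2 * m) = of_real (4 * (sin \<theta>)\<^sup>2)"
proof -
  obtain x where x: "z ^ m = of_real x" "\<bar>x\<bar> \<le> 2"
    using assms by (auto simp: star_set_def abs_le_iff)
  let ?\<theta> = "arcsin (\<bar>x\<bar> / 2)"
  have sin: "sin ?\<theta> = \<bar>x\<bar> / 2" using x by (intro sin_arcsin) auto
  have "4 * (sin ?\<theta>)\<^sup>2 = x\<^sup>2"
    unfolding sin by (simp add: power_divide)
  then have "z ^ (2 * m) = of_real (4 * (sin ?\<theta>)\<^sup>2)"
    unfolding mult.commute[of 2 m] power_mult x by simp
  moreover have "?\<theta> \<in> {0..pi/2}"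
    using x arcsin_bounded[of "\<bar>x\<bar> / 2"] by (auto intro!: arcsin_nonneg)
  ultimately show ?thesis using that by blast
qed

lemma sum_ln_dist_star_point:
  assumes \<theta>: "\<theta> \<in> {0..pi/2}" and \<phi>: "\<phi> \<in> {0..pi/2}" and neq: "\<phi> \<noteq> \<theta>"
    and z: "z ^ (2 * m) = of_real (4 * (sin \<theta>)\<^sup>2)"
  shows "\<forall>j<2*m. dist z (star_point m j \<phi>) \<noteq> 0"
    and "(\<Sum>j<2*m. ln (dist z (star_point m j \<phi>))) = log_sin (\<theta> + \<phi>) + log_sin (\<theta> - \<phi>)"
proof -
  have s: "sin \<theta> \<ge> 0" "sin \<phi> \<ge> 0" using \<theta> \<phi> by (auto intro!: sin_ge_zero)
  have "sin \<theta> \<noteq> sin \<phi>"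
    using \<theta> \<phi> neq by (intro notI) (simp add: sin_inj_pi)
  then have "sin \<theta> + sin \<phi> \<noteq> 0" "sin \<theta> - sin \<phi> \<noteq> 0" using s by auto
  then have ne: "(sin \<theta>)\<^sup>2 - (sin \<phi>)\<^sup>2 \<noteq> 0"
    by (simp add: power2_eq_square square_diff_square_factored)
  have prod: "(\<Prod>j<2*m. z - star_point m j \<phi>) = of_real (4 * ((sin \<theta>)\<^sup>2 - (sin \<phi>)\<^sup>2))"
  proof -
    have "(\<Prod>j<2*m. z - star_point m j \<phi>) = z ^ (2 * m) - of_real ((2 * sin \<phi>) powr (1 / real m)) ^ (2 * m)"
      unfolding star_point_def using m by (intro prod_diff_unity_roots) simp
    also have "complex_of_real ((2 * sin \<phi>) powr (1 / real m)) ^ (2 * m) = star_point m 0 \<phi> ^ (2 * m)"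
      by (simp add: star_point_def)
    finally show ?thesis
      unfolding z star_point_power_2m[OF \<phi>] by (simp add: algebra_simps)
  qed
  have "(\<Prod>j<2*m. z - star_point m j \<phi>) \<noteq> 0"
    unfolding prod of_real_eq_0_iff using ne by simp
  then show nz: "\<forall>j<2*m. dist z (star_point m j \<phi>) \<noteq> 0"
    by auto
  have "(\<Sum>j<2*m. ln (dist z (star_point m j \<phi>))) = ln (\<Prod>j<2*m. dist z (star_point m j \<phi>))"
    using nz by (intro ln_prod[symmetric]) auto
  also have "(\<Prod>j<2*m. dist z (star_point m j \<phi>)) = cmod (\<Prod>j<2*m. z - star_point m j \<phi>)"
    by (simp add: dist_norm prod_norm)
  also have "\<dots> = \<bar>4 * ((sin \<theta>)\<^sup>2 - (sin \<phi>)\<^sup>2)\<bar>"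
    unfolding prod norm_of_real ..
  also have "4 * ((sin \<theta>)\<^sup>2 - (sin \<phi>)\<^sup>2) = (2 * sin (\<theta> + \<phi>)) * (2 * sin (\<theta> - \<phi>))"
  proof -
    have "(2 * sin (\<theta> + \<phi>)) * (2 * sin (\<theta> - \<phi>)) = 4 * ((sin \<theta>)\<^sup>2 * (cos \<phi>)\<^sup>2 - (cos \<theta>)\<^sup>2 * (sin \<phi>)\<^sup>2)"
      by (simp add: sin_add sin_diff power2_eq_square algebra_simps)
    then show ?thesis by (simp add: cos_squared_eq algebra_simps)
  qed
  finally have *: "(\<Sum>j<2*m. ln (dist z (star_point m j \<phi>))) = ln (\<bar>2 * sin (\<theta> + \<phi>)\<bar> * \<bar>2 * sin (\<theta> - \<phi>)\<bar>)"
    by (simp add: abs_mult)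
  have "4 * ((sin \<theta>)\<^sup>2 - (sin \<phi>)\<^sup>2) = (2 * sin (\<theta> + \<phi>)) * (2 * sin (\<theta> - \<phi>))" by fact
  then have "\<bar>2 * sin (\<theta> + \<phi>)\<bar> > 0" "\<bar>2 * sin (\<theta> - \<phi>)\<bar> > 0"
    using ne by auto
  then show "(\<Sum>j<2*m. ln (dist z (star_point m j \<phi>))) = log_sin (\<theta> + \<phi>) + log_sin (\<theta> - \<phi>)"
    unfolding * log_sin_def by (rule ln_mult_pos)
qed

lemma star_potential:
  assumes z: "z \<in> star_set m"
  shows "integrable (star_measure m) (\<lambda>w. ln (dist z w))"
    and "(LINT w|star_measure m. ln (dist z w)) = 0"
proof -
  obtain \<theta> where \<theta>: "\<theta> \<in> {0..pi/2}" "z ^ (2 * m) = of_real (4 * (sin \<theta>)\<^sup>2)"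
    using star_set_param[OF z] .
  let ?T = "\<lambda>\<phi>. log_sin (\<theta> + \<phi>) + log_sin (\<theta> - \<phi>)"
  let ?h = "\<lambda>j \<phi>. ln (dist z (star_point m j \<phi>))"
  have T: "set_integrable lborel {0..pi/2} ?T" "(LINT \<phi>:{0..pi/2}|lborel. ?T \<phi>) = 0"
    using log_sin_convolution[of \<theta>] \<theta> by auto
  \<comment> \<open>Only the sum over all rays is explicit, yet each summand must be integrable. All
    distances are at most 4, so every summand is at most \<open>ln 4\<close>; subtracting the others
    from the sum then bounds each one from below.\<close>
  have bd: "\<bar>?h j \<phi>\<bar> \<le> \<bar>?T \<phi>\<bar> + real (2 * m) * ln 4" if j: "j < 2 * m" and \<phi>: "\<phi> \<in> {0..pi/2}" "\<phi> \<noteq> \<theta>" for j \<phi>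
  proof -
    note sl = sum_ln_dist_star_point[OF \<theta>(1) \<phi> \<theta>(2)]
    have up: "?h i \<phi> \<le> ln 4" if "i < 2 * m" for i
    proof -
      have "dist z (star_point m i \<phi>) \<le> cmod z + cmod (star_point m i \<phi>)"
        by (simp add: dist_norm norm_triangle_ineq4)
      also have "\<dots> \<le> 4"
        using norm_star_set[OF m z] norm_star_set[OF m star_point_in_star_set[OF m \<phi>(1), of i]] by simp
      finally show ?thesis
        using sl(1) that by (subst ln_le_cancel_iff) auto
    qed
    have "(\<Sum>i<2*m. ?h i \<phi>) = ?h j \<phi> + (\<Sum>i\<in>{..<2*m}-{j}. ?h i \<phi>)"
      using j by (intro sum.remove) auto
    moreover have "(\<Sum>i\<in>{..<2*m}-{j}. ?h i \<phi>) \<le> (\<Sum>i\<in>{..<2*m}-{j}. ln 4)"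
      using up by (intro sum_mono) auto
    moreover have "(\<Sum>i\<in>{..<2*m}-{j}. ln (4::real)) \<le> real (2 * m) * ln 4"
      using j by simp
    moreover have "ln 4 \<le> real (2 * m) * ln 4"
    proof -
      have "1 * ln 4 \<le> real (2 * m) * ln 4" using m by (intro mult_right_mono) auto
      then show ?thesis by simp
    qed
    ultimately show ?thesis
      using up[OF j] sl(2) by linarith
  qed
  have hm: "(\<lambda>w. ln (dist z w)) \<in> borel_measurable borel" by measurable
  have hi: "set_integrable lborel {0..pi/2} (?h j)" if j: "j < 2 * m" for j
    unfolding set_integrable_def
  proof (rule Bochner_Integration.integrable_bound)
    have "set_integrable lborel {0..pi/2} (\<lambda>\<phi>::real. real (2 * m) * ln 4)"
      using borel_integrable_atLeastAtMost'[of 0 "pi/2" "\<lambda>_. real (2 * m) * ln 4"] by simp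
    then show "integrable lborel (\<lambda>\<phi>. indicator {0..pi/2} \<phi> *\<^sub>R (\<bar>?T \<phi>\<bar> + real (2 * m) * ln 4))"
      using set_integral_add(1)[OF set_integrable_abs[OF T(1)]] by (simp add: set_integrable_def)
    have "?h j \<in> borel_measurable lborel"
      using measurable_compose[OF borel_measurable_star_point hm] by simp
    then show "(\<lambda>\<phi>. indicator {0..pi/2} \<phi> *\<^sub>R ?h j \<phi>) \<in> borel_measurable lborel"
      by measurable
    show "AE \<phi> in lborel. norm (indicator {0..pi/2} \<phi> *\<^sub>R ?h j \<phi>) \<le>
       norm (indicator {0..pi/2} \<phi> *\<^sub>R (\<bar>?T \<phi>\<bar> + real (2 * m) * ln 4))"
      using AE_lborel_singleton[of \<theta>]
    proof eventually_elim
      case (elim \<phi>)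
      show ?case
      proof (cases "\<phi> \<in> {0..pi/2}")
        case True
        have "norm (?h j \<phi>) \<le> norm (\<bar>?T \<phi>\<bar> + real (2 * m) * ln 4)"
          using bd[OF j True elim] by simp
        with True show ?thesis by simp
      qed simp
    qed
  qed
  show "integrable (star_measure m) (\<lambda>w. ln (dist z w))"
    by (rule star_measure_integral(1)[OF m hm hi])
  have "(\<Sum>j<2*m. (2 / pi) *\<^sub>R (LINT \<phi>:{0..pi/2}|lborel. ?h j \<phi>))
      = (2 / pi) *\<^sub>R (LINT \<phi>|lborel. (\<Sum>j<2*m. indicator {0..pi/2} \<phi> *\<^sub>R ?h j \<phi>))"
    using hi unfolding set_lebesgue_integral_def set_integrable_def
    by (subst Bochner_Integration.integral_sum) (auto simp: sum_distrib_left)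
  also have "(LINT \<phi>|lborel. (\<Sum>j<2*m. indicator {0..pi/2} \<phi> *\<^sub>R ?h j \<phi>))
      = (LINT \<phi>:{0..pi/2}|lborel. ?T \<phi>)"
    unfolding set_lebesgue_integral_def
  proof (rule integral_cong_AE)
    show "AE \<phi> in lborel. (\<Sum>j<2*m. indicator {0..pi/2} \<phi> *\<^sub>R ?h j \<phi>) = indicator {0..pi/2} \<phi> *\<^sub>R ?T \<phi>"
      using AE_lborel_singleton[of \<theta>]
    proof eventually_elim
      case (elim \<phi>)
      show ?case
      proof (cases "\<phi> \<in> {0..pi/2}")
        case True
        then show ?thesis
          using sum_ln_dist_star_point(2)[OF \<theta>(1) True elim \<theta>(2)] by simp
      qed simp
    qed
  qed (use T hi in \<open>auto simp: set_integrable_def\<close>)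
  finally have "(\<Sum>j<2*m. (2 / pi) *\<^sub>R (LINT \<phi>:{0..pi/2}|lborel. ?h j \<phi>)) = 0"
    by (simp only: T(2) scaleR_zero_right)
  then show "(LINT w|star_measure m. ln (dist z w)) = 0"
    by (simp only: star_measure_integral(2)[OF m hm hi] scaleR_zero_right)
qed

theorem equilibrium_measure_star_set: "equilibrium_measure (star_set m) = star_measure m"
  and log_capacity_star_set: "log_capacity (star_set m) = 1"
  using equilibrium_measure_of_constant_potential[OF compact_star_set[OF m]
      star_measure_prob_measures_on[OF m] star_measure_no_atoms[OF m], of 0] star_potential
  by simp_all

text \<open>The sum over the rays keeps only exponents congruent modulo 2m, and the radial factor
  |z|^(a + b) is (2 sin \<phi>)^((a + b) / m).\<close>

lemma star_moment:
  "integrable (star_measure m) (\<lambda>z. z ^ a * cnj z ^ b)"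
  "(LINT z|star_measure m. z ^ a * cnj z ^ b) =
     (if a mod (2 * m) = b mod (2 * m) then of_real (sin_moment (real (a + b) / real m)) else 0)"
proof -
  let ?p = "real (a + b) / real m"
  let ?w = "\<lambda>j. unity_root (2 * m) j ^ a * cnj (unity_root (2 * m) j) ^ b"
  have p: "?p \<ge> 0" by simp
  then have "?p > -1" by linarith
  note sp = sin_powr_integral[OF this]
  have fm: "(\<lambda>z. z ^ a * cnj z ^ b) \<in> borel_measurable borel"
    by (intro borel_measurable_continuous_onI continuous_intros)
  \<comment> \<open>The angle 0 is excluded because of a = b = 0: the left side is then 1, whereas
    \<open>0 powr 0 = 0\<close>.\<close>
  have eq: "star_point m j \<phi> ^ a * cnj (star_point m j \<phi>) ^ b = ?w j * of_real ((2 * sin \<phi>) powr ?p)"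
    if "\<phi> \<in> {0..pi/2}" "\<phi> \<noteq> 0" for j \<phi>
  proof -
    have "sin \<phi> > 0" using that by (intro sin_gt_zero) (auto intro: less_le_trans)
    then have s: "(2 * sin \<phi>) powr (1 / real m) > 0" by simp
    have "((2 * sin \<phi>) powr (1 / real m)) ^ (a + b) = (2 * sin \<phi>) powr ?p"
      unfolding powr_realpow[OF s, symmetric] powr_powr by simp
    then have "complex_of_real ((2 * sin \<phi>) powr ?p) = of_real ((2 * sin \<phi>) powr (1 / real m)) ^ a * of_real ((2 * sin \<phi>) powr (1 / real m)) ^ b"
      by (metis of_real_power power_add)
    then show ?thesis
      by (simp add: star_point_def power_mult_distrib)
  qed
  have ae: "AE \<phi> in lborel. indicator {0..pi/2} \<phi> *\<^sub>R (star_point m j \<phi> ^ a * cnj (star_point m j \<phi>) ^ b)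
      = ?w j * of_real (indicator {0..pi/2} \<phi> *\<^sub>R (2 * sin \<phi>) powr ?p)" for j
    using AE_lborel_singleton[of 0]
  proof eventually_elim
    case (elim \<phi>)
    then show ?case by (cases "\<phi> \<in> {0..pi/2}") (simp_all add: eq)
  qed
  have m1: "(\<lambda>\<phi>. indicator {0..pi/2} \<phi> *\<^sub>R (star_point m j \<phi> ^ a * cnj (star_point m j \<phi>) ^ b)) \<in> borel_measurable lborel" for j
    using measurable_compose[OF borel_measurable_star_point fm, of m j] by simp
  have hb: "has_bochner_integral lborel (\<lambda>\<phi>. indicator {0..pi/2} \<phi> *\<^sub>R (star_point m j \<phi> ^ a * cnj (star_point m j \<phi>) ^ b))
     (?w j * of_real (pi / 2 * sin_moment ?p))" for j
  proof -
    have "has_bochner_integral lborel (\<lambda>\<phi>. indicator {0..pi/2} \<phi> *\<^sub>R (2 * sin \<phi>) powr ?p) (pi / 2 * sin_moment ?p)"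
      using sp by (simp add: has_bochner_integral_iff set_integrable_def set_lebesgue_integral_def)
    then have h: "has_bochner_integral lborel (\<lambda>\<phi>. ?w j * of_real (indicator {0..pi/2} \<phi> *\<^sub>R (2 * sin \<phi>) powr ?p))
       (?w j * of_real (pi / 2 * sin_moment ?p))"
      by (intro has_bochner_integral_mult_right has_bochner_integral_of_real)
    show ?thesis
      by (subst has_bochner_integral_cong_AE[OF m1 _ ae])
        (use h in \<open>auto dest: borel_measurable_has_bochner_integral\<close>)
  qed
  have i: "set_integrable lborel {0..pi/2} (\<lambda>\<phi>. star_point m j \<phi> ^ a * cnj (star_point m j \<phi>) ^ b)" for j
    using hb[of j] by (auto simp: set_integrable_def has_bochner_integral_iff)
  have v: "(LINT \<phi>:{0..pi/2}|lborel. star_point m j \<phi> ^ a * cnj (star_point m j \<phi>) ^ b) = ?w j * of_real (pi / 2 * sin_moment ?p)" for j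
    using hb[of j] by (auto simp: set_lebesgue_integral_def has_bochner_integral_iff)
  show "integrable (star_measure m) (\<lambda>z. z ^ a * cnj z ^ b)"
    by (rule star_measure_integral(1)[OF m fm i])
  have "(LINT z|star_measure m. z ^ a * cnj z ^ b) = (1 / real (2 * m)) *\<^sub>R
       ((\<Sum>j<2*m. ?w j) * of_real (sin_moment ?p))"
    unfolding star_measure_integral(2)[OF m fm i] v sum_distrib_right
    by (intro arg_cong[of _ _ "(*\<^sub>R) _"] sum.cong refl) (simp add: scaleR_conv_of_real)
  also have "(\<Sum>j<2*m. ?w j) = (if a mod (2 * m) = b mod (2 * m) then of_nat (2 * m) else 0)"
    using m by (intro sum_unity_roots) simp
  finally show "(LINT z|star_measure m. z ^ a * cnj z ^ b) =
     (if a mod (2 * m) = b mod (2 * m) then of_real (sin_moment (real (a + b) / real m)) else 0)"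
    using m by (simp add: scaleR_conv_of_real)
qed

end

section \<open>Jacobi polynomials and their norms\<close>

text \<open>Up to sign these sums are iterated finite differences of f at 0; Pascal's rule splits
  off one difference.\<close>

lemma alternating_binomial_sum_Suc:
  fixes f :: "nat \<Rightarrow> real"
  shows "(\<Sum>k\<le>Suc n. (-1) ^ k * real (Suc n choose k) * f k)
     = (\<Sum>k\<le>n. (-1) ^ k * real (n choose k) * (f k - f (Suc k)))"
proof -
  have "(\<Sum>k\<le>Suc n. (-1) ^ k * real (Suc n choose k) * f k)
     = f 0 + (\<Sum>k\<le>n. (-1) ^ Suc k * real (Suc n choose Suc k) * f (Suc k))"
    by (subst sum.atMost_Suc_shift) simp
  also have "(\<Sum>k\<le>n. (-1) ^ Suc k * real (Suc n choose Suc k) * f (Suc k))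
     = (\<Sum>k\<le>n. (-1) ^ Suc k * real (n choose Suc k) * f (Suc k)) - (\<Sum>k\<le>n. (-1) ^ k * real (n choose k) * f (Suc k))"
    unfolding sum_subtractf[symmetric] by (intro sum.cong refl) (simp add: algebra_simps)
  also have "f 0 + \<dots> = (\<Sum>k\<le>Suc n. (-1) ^ k * real (n choose k) * f k) - (\<Sum>k\<le>n. (-1) ^ k * real (n choose k) * f (Suc k))"
    by (subst sum.atMost_Suc_shift) simp
  also have "\<dots> = (\<Sum>k\<le>n. (-1) ^ k * real (n choose k) * (f k - f (Suc k)))"
    by (simp add: sum_subtractf algebra_simps)
  finally show ?thesis .
qed

lemma degree_diff_shift_less:
  fixes p :: "real poly"
  assumes "degree p > 0"
  shows "degree (p - pcompose p [:1, 1:]) < degree p"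
proof -
  have "degree (pcompose p [:1, 1:]) = degree p"
    by (simp add: degree_pcompose)
  moreover have "lead_coeff (pcompose p [:1, 1:]) = lead_coeff p"
    by (subst lead_coeff_comp) auto
  ultimately have "coeff (p - pcompose p [:1, 1:]) (degree p) = 0"
    by simp
  moreover have "degree (p - pcompose p [:1, 1:]) \<le> degree p"
    by (intro degree_diff_le) (simp_all add: degree_pcompose)
  ultimately show ?thesis
    using assms by (metis degree_0 leading_coeff_0_iff le_neq_implies_less)
qed

text \<open>Each difference lowers the degree, so n of them annihilate p. Constants form a case of
  their own, since their difference is 0, whose degree is no smaller.\<close>

lemma alternating_binomial_sum_poly:
  fixes p :: "real poly"
  assumes "degree p < n"
  shows "(\<Sum>k\<le>n. (-1) ^ k * real (n choose k) * poly p (real k)) = 0"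
  using assms
proof (induction n arbitrary: p)
  case (Suc n)
  have "(\<Sum>k\<le>Suc n. (-1) ^ k * real (Suc n choose k) * poly p (real k))
      = (\<Sum>k\<le>n. (-1) ^ k * real (n choose k) * poly (p - pcompose p [:1, 1:]) (real k))"
    unfolding alternating_binomial_sum_Suc by (simp add: poly_pcompose add.commute)
  also have "\<dots> = 0"
  proof (cases "degree p = 0")
    case True
    then obtain a where "p = [:a:]" by (metis degree_eq_zeroE)
    then show ?thesis by (simp add: pcompose_const)
  next
    case False
    then have "degree (p - pcompose p [:1, 1:]) < n"
      using degree_diff_shift_less[of p] Suc.prems by linarith
    then show ?thesis by (rule Suc.IH)
  qed
  finally show ?case .
qed simp

text \<open>Both sides equal the integral of t^(x - 1) (1 - t)^n over [0, 1]. The induction avoids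
  the integral: one difference relates the value n + 1 at x to the values n at x and x + 1.\<close>

lemma alternating_binomial_sum_inverse:
  fixes x :: real
  assumes "x > 0"
  shows "(\<Sum>k\<le>n. (-1) ^ k * real (n choose k) * (1 / (x + real k))) = fact n / pochhammer x (Suc n)"
  using assms
proof (induction n arbitrary: x)
  case (Suc n)
  have pos: "pochhammer (x + 1) n > 0" using Suc.prems by (intro pochhammer_pos) simp
  have "(\<Sum>k\<le>Suc n. (-1) ^ k * real (Suc n choose k) * (1 / (x + real k)))
      = (\<Sum>k\<le>n. (-1) ^ k * real (n choose k) * (1 / (x + real k)))
        - (\<Sum>k\<le>n. (-1) ^ k * real (n choose k) * (1 / ((x + 1) + real k)))"
    unfolding alternating_binomial_sum_Suc by (simp add: sum_subtractf algebra_simps)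
  also have "\<dots> = fact n / pochhammer x (Suc n) - fact n / pochhammer (x + 1) (Suc n)"
    using Suc.IH[of x] Suc.IH[of "x + 1"] Suc.prems by simp
  also have "pochhammer x (Suc n) = x * pochhammer (x + 1) n"
    by (rule pochhammer_rec)
  also have "pochhammer (x + 1) (Suc n) = (x + 1 + real n) * pochhammer (x + 1) n"
    by (simp add: pochhammer_Suc mult.commute)
  also have "fact n / (x * pochhammer (x + 1) n) - fact n / ((x + 1 + real n) * pochhammer (x + 1) n)
      = fact (Suc n) / (x * ((x + 1 + real n) * pochhammer (x + 1) n))"
    using pos Suc.prems by (simp add: divide_simps) (simp add: algebra_simps)
  also have "x * ((x + 1 + real n) * pochhammer (x + 1) n) = pochhammer x (Suc (Suc n))"
    by (simp add: pochhammer_rec[of x "Suc n"] pochhammer_Suc[of "x + 1"] mult.commute)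
  finally show ?case .
qed simp

lemma pochhammer_shift_poly:
  obtains p :: "real poly" where "degree p = q" "\<And>x. poly p x = pochhammer (x + a) q"
proof
  let ?p = "\<Prod>i<q. [:a + real i, 1:]"
  show "degree ?p = q"
    by (subst degree_prod_eq_sum_degree) auto
  show "poly ?p x = pochhammer (x + a) q" for x
    by (simp add: poly_prod pochhammer_prod algebra_simps atLeast0LessThan)
qed

text \<open>The coefficient of u^k in the monic multiple of the hypergeometric polynomial 2F1(-n, n
  + s; s + 1/2; u/4). With u = z^(2m) = 4 sin^2 \<phi>, the factor |z|^(2l) and the density of u
  produce the weight u^(s - 1/2) (4 - u)^(-1/2) up to a constant; rescaling from [0, 1] to [0, 4]
  causes the powers of -4.\<close>

definition jacobi_coeff :: "nat \<Rightarrow> real \<Rightarrow> nat \<Rightarrow> real" where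
  "jacobi_coeff n s k = (-4) ^ (n - k) * real (n choose k)
     * pochhammer (s + 1 / 2 + real k) (n - k) / pochhammer (real n + s + real k) (n - k)"

text \<open>The squared norm \<open>4^(s + 2n) h_n\<close>, where \<open>h_n\<close> is that of the monic Jacobi polynomial on
  \<open>[0, 1]\<close> for the weight \<open>u^(s - 1/2) (1 - u)^(- 1/2) / \<pi>\<close>, simplified by the duplication formula.
  For \<open>n = 0\<close>, \<open>s = 0\<close> this is a junk value, as \<open>Gamma 0 = 0\<close>.\<close>

definition widom_sq :: "nat \<Rightarrow> real \<Rightarrow> real" where
  "widom_sq n s = 2 * (Gamma (2 * real n + 1) * Gamma (2 * real n + 2 * s))
     / (Gamma (2 * real n + s) * Gamma (2 * real n + s + 1))"

lemma jacobi_coeff_leading: "jacobi_coeff n s n = 1"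
  by (simp add: jacobi_coeff_def)

lemma Gamma_pochhammer:
  fixes x :: real
  assumes "x > 0"
  shows "Gamma (x + real n) = pochhammer x n * Gamma x"
proof -
  have "x \<notin> \<int>\<^sub>\<le>\<^sub>0" using assms by (auto elim!: nonpos_Ints_cases)
  moreover have "Gamma x \<noteq> 0" using Gamma_real_pos[OF assms] by simp
  ultimately show ?thesis by (simp add: pochhammer_Gamma)
qed

lemma Gamma_duplication_real:
  fixes x :: real
  assumes "x > 0"
  shows "Gamma x * Gamma (x + 1/2) = 2 powr (1 - 2 * x) * sqrt pi * Gamma (2 * x)"
proof -
  have "complex_of_real x \<notin> \<int>\<^sub>\<le>\<^sub>0" "complex_of_real (x + 1/2) \<notin> \<int>\<^sub>\<le>\<^sub>0"
    using assms unfolding of_real_in_nonpos_Ints_iff by (auto elim!: nonpos_Ints_cases)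
  then have "Gamma (complex_of_real x) * Gamma (complex_of_real (x + 1/2)) =
     exp ((1 - 2 * complex_of_real x) * of_real (ln 2)) * of_real (sqrt pi) * Gamma (2 * complex_of_real x)"
    using Gamma_legendre_duplication[of "complex_of_real x"] by simp
  also have "(1 - 2 * complex_of_real x) * of_real (ln 2) = of_real ((1 - 2 * x) * ln 2)"
    by simp
  also have "2 * complex_of_real x = of_real (2 * x)"
    by simp
  finally have "complex_of_real (Gamma x * Gamma (x + 1/2)) = of_real (exp ((1 - 2 * x) * ln 2) * sqrt pi * Gamma (2 * x))"
    by (simp only: Gamma_complex_of_real exp_of_real of_real_mult[symmetric])
  then show ?thesis
    by (simp only: of_real_eq_iff powr_def) simp
qed

context
  fixes n :: nat and s :: real
  assumes s: "s \<ge> 0" and ns: "real n + s > 0"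
begin

text \<open>Writing the Pochhammer symbols as Gamma quotients lets
  \<open>Gamma (s + 1/2 + k)\<close> from the coefficient meet the numerator of the moment in a
  Pochhammer symbol of length q. The powers of 2 and 4 lose their dependence on k, and an
  alternating binomial sum remains.\<close>

lemma jacobi_coeff_moment:
  assumes "k \<le> n"
  shows "jacobi_coeff n s k * sin_moment (2 * real (k + q) + 2 * s) =
     (-1) ^ n * 4 powr (real (n + q) + s) / sqrt pi * Gamma (real n + s + 1/2) / Gamma (2 * real n + s)
     * ((-1) ^ k * real (n choose k) * (pochhammer (real k + (s + 1/2)) q
          * (Gamma (real n + s + real k) / Gamma (real k + real q + s + 1))))"
proof -
  have p1: "s + 1/2 + real k > 0" "real n + s + real k > 0" using s ns by auto
  note g = Gamma_real_pos[OF p1(1)] Gamma_real_pos[OF p1(2)]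
  have a: "pochhammer (s + 1 / 2 + real k) (n - k) = Gamma (real n + s + 1/2) / Gamma (s + 1/2 + real k)"
    using Gamma_pochhammer[OF p1(1), of "n - k"] assms g by (simp add: of_nat_diff algebra_simps)
  have b: "pochhammer (real n + s + real k) (n - k) = Gamma (2 * real n + s) / Gamma (real n + s + real k)"
    using Gamma_pochhammer[OF p1(2), of "n - k"] assms g by (simp add: of_nat_diff algebra_simps)
  have c: "pochhammer (real k + (s + 1/2)) q = Gamma (real k + real q + s + 1/2) / Gamma (s + 1/2 + real k)"
    using Gamma_pochhammer[OF p1(1), of q] g by (simp add: algebra_simps)
  have d: "(-4 :: real) ^ (n - k) * 2 powr (2 * real (k + q) + 2 * s) = (-1) ^ n * (-1) ^ k * 4 powr (real (n + q) + s)"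
  proof -
    have "(2::real) powr (2 * real (k + q) + 2 * s) = (2 powr 2) powr (real (k + q) + s)"
      unfolding powr_powr by (simp add: algebra_simps)
    then have 1: "(2::real) powr (2 * real (k + q) + 2 * s) = 4 powr (real (k + q) + s)" by simp
    have 2: "(-4 :: real) ^ (n - k) = (-1) ^ (n - k) * 4 powr real (n - k)"
      by (simp add: powr_realpow flip: power_mult_distrib)
    have 3: "(-1 :: real) ^ (n - k) = (-1) ^ n * (-1) ^ k"
    proof -
      obtain e where "n = k + e" using assms by (auto simp: le_iff_add)
      then show ?thesis by (cases "even k") (simp_all add: power_add)
    qed
    have "(4::real) powr real (n - k) * 4 powr (real (k + q) + s) = 4 powr (real (n + q) + s)"
      unfolding powr_add[symmetric] using assms by (intro arg_cong[of _ _ "(powr) 4"]) (simp add: of_nat_diff)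
    then show ?thesis unfolding 1 2 3 by simp
  qed
  have e: "sin_moment (2 * real (k + q) + 2 * s) = 2 powr (2 * real (k + q) + 2 * s) * Gamma (real k + real q + s + 1/2)
      / (sqrt pi * Gamma (real k + real q + s + 1))"
    unfolding sin_moment_def by (simp add: add_divide_distrib algebra_simps)
  have "jacobi_coeff n s k * sin_moment (2 * real (k + q) + 2 * s) =
     ((-4) ^ (n - k) * 2 powr (2 * real (k + q) + 2 * s)) * real (n choose k)
      * (Gamma (real n + s + 1/2) / Gamma (s + 1/2 + real k)) / (Gamma (2 * real n + s) / Gamma (real n + s + real k))
      * Gamma (real k + real q + s + 1/2) / (sqrt pi * Gamma (real k + real q + s + 1))"
    unfolding jacobi_coeff_def a b e by simp
  also have "\<dots> = (-1) ^ n * 4 powr (real (n + q) + s) / sqrt pi * Gamma (real n + s + 1/2) / Gamma (2 * real n + s)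
     * ((-1) ^ k * real (n choose k) * (pochhammer (real k + (s + 1/2)) q
          * (Gamma (real n + s + real k) / Gamma (real k + real q + s + 1))))"
    unfolding c d by (simp add: ac_simps)
  finally show ?thesis .
qed

lemma jacobi_moment_sum:
  "(\<Sum>k\<le>n. jacobi_coeff n s k * sin_moment (2 * real (k + q) + 2 * s)) =
     (-1) ^ n * 4 powr (real (n + q) + s) / sqrt pi * Gamma (real n + s + 1/2) / Gamma (2 * real n + s)
     * (\<Sum>k\<le>n. (-1) ^ k * real (n choose k) * (pochhammer (real k + (s + 1/2)) q
          * (Gamma (real n + s + real k) / Gamma (real k + real q + s + 1))))"
  unfolding sum_distrib_left by (rule sum.cong[OF refl], rule jacobi_coeff_moment) simp

text \<open>For \<open>q < n\<close> the Gamma quotient is a polynomial in \<open>k\<close> and the summand is, up to the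
  alternating binomial, a polynomial of degree \<open>n - 1\<close>, which the \<open>n\<close>-th difference kills.\<close>

lemma jacobi_orthogonal:
  assumes "q < n"
  shows "(\<Sum>k\<le>n. jacobi_coeff n s k * sin_moment (2 * real (k + q) + 2 * s)) = 0"
proof -
  obtain p1 :: "real poly" where p1: "degree p1 = q" "\<And>x. poly p1 x = pochhammer (x + (s + 1/2)) q"
    using pochhammer_shift_poly[of q "s + 1/2"] by blast
  obtain p2 :: "real poly" where p2: "degree p2 = n - 1 - q" "\<And>x. poly p2 x = pochhammer (x + (real q + s + 1)) (n - 1 - q)"
    using pochhammer_shift_poly[of "n - 1 - q" "real q + s + 1"] by blast
  have "Gamma (real n + s + real k) / Gamma (real k + real q + s + 1) = poly p2 (real k)" for k
  proof -
    have "real k + (real q + s + 1) > 0" using s by simp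
    from Gamma_pochhammer[OF this, of "n - 1 - q"] Gamma_real_pos[OF this] show ?thesis
      using assms unfolding p2 by (simp add: of_nat_diff field_simps)
  qed
  then have "(\<Sum>k\<le>n. (-1) ^ k * real (n choose k) * (pochhammer (real k + (s + 1/2)) q
          * (Gamma (real n + s + real k) / Gamma (real k + real q + s + 1))))
     = (\<Sum>k\<le>n. (-1) ^ k * real (n choose k) * poly (p1 * p2) (real k))"
    by (simp add: p1)
  also have "\<dots> = 0"
    using degree_mult_le[of p1 p2] p1 p2 assms by (intro alternating_binomial_sum_poly) linarith
  finally show ?thesis unfolding jacobi_moment_sum by simp
qed

text \<open>For \<open>q = n\<close> the Gamma quotient is \<open>1 / (n + s + k)\<close>; dividing the Pochhammer polynomial by
  this linear factor leaves only the remainder.\<close>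

lemma jacobi_norm:
  "(\<Sum>k\<le>n. jacobi_coeff n s k * sin_moment (2 * real (k + n) + 2 * s)) = widom_sq n s"
proof -
  obtain p :: "real poly" where p: "degree p = n" "\<And>x. poly p x = pochhammer (x + (s + 1/2)) n"
    using pochhammer_shift_poly[of n "s + 1/2"] by blast
  let ?c = "- (real n + s)"
  define d where "d = synthetic_div p ?c"
  define r where "r = pochhammer (1/2 :: real) n"
  \<comment> \<open>At this point the argument of the Pochhammer symbol is 1/2 - n, so its factors
    are those of r in reverse order and with opposite signs.\<close>
  have pc: "poly p ?c = (-1) ^ n * r"
    using pochhammer_minus[of "real n - 1/2" n] by (simp add: p r_def)
  have pd: "poly p x = (x + real n + s) * poly d x + (-1) ^ n * r" for x
  proof -
    have "poly p x = poly ([:- ?c, 1:] * d + [:poly p ?c:]) x"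
      unfolding d_def synthetic_div_correct' ..
    then show ?thesis unfolding pc by (simp add: algebra_simps)
  qed
  have d0: "(\<Sum>k\<le>n. (-1) ^ k * real (n choose k) * poly d (real k)) = 0"
  proof (cases "n = 0")
    \<comment> \<open>No degree is below n = 0, but then p is constant and its quotient d is
      0.\<close>
    case True
    then have "d = 0" unfolding d_def using p by (simp add: synthetic_div_eq_0_iff)
    then show ?thesis by simp
  next
    case False
    then show ?thesis
      by (intro alternating_binomial_sum_poly) (simp add: d_def degree_synthetic_div p)
  qed
  have bracket: "pochhammer (real k + (s + 1/2)) n * (Gamma (real n + s + real k) / Gamma (real k + real n + s + 1))
     = poly d (real k) + (-1) ^ n * r * (1 / ((real n + s) + real k))" for k
  proof -
    have x: "real n + s + real k > 0" using ns by simp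
    have "Gamma (real k + real n + s + 1) = (real n + s + real k) * Gamma (real n + s + real k)"
      using Gamma_pochhammer[OF x, of 1] by (simp add: algebra_simps)
    then have "Gamma (real n + s + real k) / Gamma (real k + real n + s + 1) = 1 / (real n + s + real k)"
      using Gamma_real_pos[OF x] by simp
    then show ?thesis
      using x unfolding p(2)[symmetric] pd by (simp add: field_simps)
  qed
  have "(\<Sum>k\<le>n. (-1) ^ k * real (n choose k) * (pochhammer (real k + (s + 1/2)) n
          * (Gamma (real n + s + real k) / Gamma (real k + real n + s + 1))))
    = (\<Sum>k\<le>n. (-1) ^ k * real (n choose k) * poly d (real k))
      + (-1) ^ n * r * (\<Sum>k\<le>n. (-1) ^ k * real (n choose k) * (1 / ((real n + s) + real k)))"
    unfolding bracket sum_distrib_left sum.distrib[symmetric]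
    by (intro sum.cong refl) (simp add: algebra_simps)
  also have "\<dots> = (-1) ^ n * r * (fact n / pochhammer (real n + s) (Suc n))"
    unfolding d0 alternating_binomial_sum_inverse[OF ns] by simp
  finally have eq: "(\<Sum>k\<le>n. jacobi_coeff n s k * sin_moment (2 * real (k + n) + 2 * s)) =
     4 powr (2 * real n + s) / sqrt pi * Gamma (real n + s + 1/2) / Gamma (2 * real n + s)
     * (r * (fact n / pochhammer (real n + s) (Suc n)))"
    unfolding jacobi_moment_sum by (simp add: power_mult_distrib[symmetric])
  have g: "Gamma (real n + s) > 0" "Gamma (2 * real n + s) > 0" "Gamma (2 * real n + s + 1) > 0"
    using s ns by (auto intro!: Gamma_real_pos)
  have r: "r = Gamma (real n + 1/2) / sqrt pi"
    using Gamma_pochhammer[of "1/2" n] by (simp add: r_def Gamma_one_half_real add.commute)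
  have q: "pochhammer (real n + s) (Suc n) = Gamma (2 * real n + s + 1) / Gamma (real n + s)"
    using Gamma_pochhammer[OF ns, of "Suc n"] g by (simp add: algebra_simps)
  have f: "fact n = Gamma (real n + 1)"
    by (simp add: Gamma_fact add.commute)
  have L1: "Gamma (real n + 1/2) * Gamma (real n + 1) = 2 powr (- 2 * real n) * sqrt pi * Gamma (2 * real n + 1)"
    using Gamma_duplication_real[of "real n + 1/2"] by (simp add: algebra_simps)
  have L2: "Gamma (real n + s) * Gamma (real n + s + 1/2) = 2 powr (1 - 2 * real n - 2 * s) * sqrt pi * Gamma (2 * real n + 2 * s)"
    using Gamma_duplication_real[OF ns] by (simp add: algebra_simps)
  \<comment> \<open>The powers of 2 from the two duplications cancel
    \<open>4 powr (2 * n + s)\<close> up to a single factor 2, which becomes the limit of the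
    squared Widom factors.\<close>
  have P: "(4::real) powr (2 * real n + s) * (2 powr (- 2 * real n) * 2 powr (1 - 2 * real n - 2 * s)) = 2"
  proof -
    have "(4::real) powr (2 * real n + s) = (2 powr 2) powr (2 * real n + s)"
      by simp
    also have "\<dots> = 2 powr (2 * (2 * real n + s))"
      by (rule powr_powr)
    finally show ?thesis by (simp flip: powr_add)
  qed
  have "(\<Sum>k\<le>n. jacobi_coeff n s k * sin_moment (2 * real (k + n) + 2 * s)) =
     4 powr (2 * real n + s) * ((Gamma (real n + 1/2) * Gamma (real n + 1)) * (Gamma (real n + s) * Gamma (real n + s + 1/2)))
     / (sqrt pi * sqrt pi * (Gamma (2 * real n + s) * Gamma (2 * real n + s + 1)))"
    unfolding eq r q f by (simp add: ac_simps del: real_sqrt_mult_self)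
  also have "\<dots> = (4 powr (2 * real n + s) * (2 powr (- 2 * real n) * 2 powr (1 - 2 * real n - 2 * s)))
      * (Gamma (2 * real n + 1) * Gamma (2 * real n + 2 * s)) / (Gamma (2 * real n + s) * Gamma (2 * real n + s + 1))"
    unfolding L1 L2 by (simp del: real_sqrt_mult_self)
  finally show ?thesis
    unfolding P widom_sq_def .
qed

lemma widom_sq_pos: "widom_sq n s > 0"
  unfolding widom_sq_def using s ns
  by (intro divide_pos_pos mult_pos_pos Gamma_real_pos) auto

end

section \<open>Monotonicity and limit of the squared norms\<close>

lemma widom_sq_Suc:
  fixes n :: nat and s :: real
  assumes "s > 0"
  defines "Y \<equiv> 2 * real n + 1 + s"
  shows "widom_sq (Suc n) s = widom_sq n s * ((Y\<^sup>2 - s\<^sup>2) * (Y\<^sup>2 - (1 - s)\<^sup>2) / (Y\<^sup>2 * (Y\<^sup>2 - 1)))"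
proof -
  have G2: "Gamma (x + 2) = x * (x + 1) * Gamma x" if "x > 0" for x :: real
    using Gamma_pochhammer[OF that, of 2] by (simp add: numeral_2_eq_2 pochhammer_Suc)
  \<comment> \<open>Y centres all the linear factors: a = Y - s, a + 1 = Y + (1 - s), b = Y - (1 -
    s), b + 1 = Y + s, while c = Y - 1, c + 1 = d = Y and d + 1 = Y + 1.\<close>
  define a b c d where "a = 2 * real n + 1" and "b = 2 * real n + 2 * s" and "c = 2 * real n + s" and "d = 2 * real n + s + 1"
  have pos: "a > 0" "b > 0" "c > 0" "d > 0" using assms by (auto simp: a_def b_def c_def d_def)
  note g = Gamma_real_pos[OF pos(1)] Gamma_real_pos[OF pos(2)] Gamma_real_pos[OF pos(3)] Gamma_real_pos[OF pos(4)]
  have "widom_sq (Suc n) s = 2 * (Gamma (a + 2) * Gamma (b + 2)) / (Gamma (c + 2) * Gamma (d + 2))"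
    unfolding widom_sq_def a_def b_def c_def d_def by (simp add: algebra_simps)
  also have "\<dots> = (2 * (Gamma a * Gamma b) / (Gamma c * Gamma d)) * ((a * (a + 1) * (b * (b + 1))) / (c * (c + 1) * (d * (d + 1))))"
    unfolding G2[OF pos(1)] G2[OF pos(2)] G2[OF pos(3)] G2[OF pos(4)] by (simp add: ac_simps)
  also have "2 * (Gamma a * Gamma b) / (Gamma c * Gamma d) = widom_sq n s"
    by (simp add: widom_sq_def a_def b_def c_def d_def)
  also have "a * (a + 1) * (b * (b + 1)) = (Y\<^sup>2 - s\<^sup>2) * (Y\<^sup>2 - (1 - s)\<^sup>2)"
    unfolding a_def b_def Y_def by (simp add: power2_eq_square algebra_simps)
  also have "c * (c + 1) * (d * (d + 1)) = Y\<^sup>2 * (Y\<^sup>2 - 1)"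
    unfolding c_def d_def Y_def by (simp add: power2_eq_square algebra_simps)
  finally show ?thesis .
qed

text \<open>Numerator minus denominator is s (1 - s) (2 Y^2 + s (1 - s)). The last factor is
  nonnegative for Y >= 1 + s, so the sign of 1 - s decides.\<close>

lemma widom_sq_ratio:
  fixes Y s :: real
  defines "R \<equiv> (Y\<^sup>2 - s\<^sup>2) * (Y\<^sup>2 - (1 - s)\<^sup>2) / (Y\<^sup>2 * (Y\<^sup>2 - 1))"
  assumes "s > 0" "Y \<ge> 1 + s"
  shows "s < 1 \<Longrightarrow> R \<ge> 1" "1 < s \<Longrightarrow> R \<le> 1"
proof -
  have "1 < Y" using assms by simp
  then have Y1: "1 < Y\<^sup>2" by simp
  then have den: "Y\<^sup>2 * (Y\<^sup>2 - 1) > 0" by (intro mult_pos_pos) auto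
  have diff: "(Y\<^sup>2 - s\<^sup>2) * (Y\<^sup>2 - (1 - s)\<^sup>2) - Y\<^sup>2 * (Y\<^sup>2 - 1) = s * (1 - s) * (2 * Y\<^sup>2 + s * (1 - s))"
    by (simp add: power2_eq_square algebra_simps)
  have "(1 + s)\<^sup>2 \<le> Y\<^sup>2" using assms by (intro power_mono) auto
  moreover have "s * (s - 1) \<le> (1 + s)\<^sup>2" using assms by (simp add: power2_eq_square algebra_simps)
  ultimately have "0 \<le> 2 * Y\<^sup>2 + s * (1 - s)" using Y1 by (simp add: algebra_simps)
  note pos = this
  show "R \<ge> 1" if "s < 1"
  proof -
    have "0 \<le> s * (1 - s) * (2 * Y\<^sup>2 + s * (1 - s))" using that assms pos by (intro mult_nonneg_nonneg) auto
    then show ?thesis using den diff unfolding R_def by (subst le_divide_eq_1_pos) auto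
  qed
  show "R \<le> 1" if "1 < s"
  proof -
    have "s * (1 - s) * (2 * Y\<^sup>2 + s * (1 - s)) \<le> 0"
      using that assms pos by (intro mult_nonpos_nonneg mult_nonneg_nonpos) auto
    then show ?thesis using den diff unfolding R_def by (subst divide_le_eq_1_pos) auto
  qed
qed

lemma incseq_widom_sq:
  assumes "0 < s" "s < 1"
  shows "incseq (\<lambda>n. widom_sq n s)"
proof (rule incseq_SucI)
  fix n
  have "widom_sq n s * 1 \<le> widom_sq (Suc n) s"
    unfolding widom_sq_Suc[OF assms(1)] using widom_sq_pos[of s n] assms
    by (intro mult_left_mono widom_sq_ratio) auto
  then show "widom_sq n s \<le> widom_sq (Suc n) s" by simp
qed

lemma decseq_widom_sq:
  assumes "1 < s"
  shows "decseq (\<lambda>n. widom_sq n s)"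
proof (rule decseq_SucI)
  fix n
  have "s > 0" using assms by simp
  then have "widom_sq (Suc n) s \<le> widom_sq n s * 1"
    unfolding widom_sq_Suc[OF \<open>s > 0\<close>] using widom_sq_pos[of s n] assms
    by (intro mult_left_mono widom_sq_ratio) auto
  then show "widom_sq (Suc n) s \<le> widom_sq n s" by simp
qed

text \<open>Euler's limit: \<open>Gamma_series x N\<close> tends to Gamma x and has a Pochhammer
  symbol of length N + 1 in its denominator, whence the shift by N + 1. The balance a + b = c + d
  makes the powers of N cancel.\<close>

lemma Gamma_ratio_LIMSEQ:
  fixes a b c d :: real
  assumes pos: "a > 0" "b > 0" "c > 0" "d > 0" and eq: "a + b = c + d"
  shows "(\<lambda>N. Gamma (a + real (N + 1)) * Gamma (b + real (N + 1)) / (Gamma (c + real (N + 1)) * Gamma (d + real (N + 1)))) \<longlonglongrightarrow> 1"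
proof -
  note g = Gamma_real_pos[OF pos(1)] Gamma_real_pos[OF pos(2)] Gamma_real_pos[OF pos(3)] Gamma_real_pos[OF pos(4)]
  have G: "Gamma (x + real (N + 1)) = fact N * exp (x * ln (real N)) * Gamma x / Gamma_series x N" if "x > 0" for x N
    using pochhammer_pos[OF that, of "N + 1"] unfolding Gamma_pochhammer[OF that] Gamma_series_def by simp
  have ratio: "Gamma (a + real (N + 1)) * Gamma (b + real (N + 1)) / (Gamma (c + real (N + 1)) * Gamma (d + real (N + 1)))
     = (Gamma a * Gamma b / (Gamma c * Gamma d)) * (Gamma_series c N * Gamma_series d N / (Gamma_series a N * Gamma_series b N))" for N
  proof -
    have "exp (a * ln (real N)) * exp (b * ln (real N)) = exp (c * ln (real N)) * exp (d * ln (real N))"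
      unfolding exp_add[symmetric] distrib_right[symmetric] eq ..
    then have "(fact N * fact N * (exp (a * ln (real N)) * exp (b * ln (real N)))) /
        (fact N * fact N * (exp (c * ln (real N)) * exp (d * ln (real N)))) = (1::real)"
      by simp
    moreover have "Gamma (a + real (N + 1)) * Gamma (b + real (N + 1)) / (Gamma (c + real (N + 1)) * Gamma (d + real (N + 1)))
      = (fact N * fact N * (exp (a * ln (real N)) * exp (b * ln (real N)))) /
        (fact N * fact N * (exp (c * ln (real N)) * exp (d * ln (real N)))) *
       ((Gamma a * Gamma b / (Gamma c * Gamma d)) * (Gamma_series c N * Gamma_series d N / (Gamma_series a N * Gamma_series b N)))"
      unfolding G[OF pos(1)] G[OF pos(2)] G[OF pos(3)] G[OF pos(4)] by (simp add: ac_simps)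
    ultimately show ?thesis by simp
  qed
  have lim: "(\<lambda>N. (Gamma a * Gamma b / (Gamma c * Gamma d)) * (Gamma_series c N * Gamma_series d N / (Gamma_series a N * Gamma_series b N)))
     \<longlonglongrightarrow> (Gamma a * Gamma b / (Gamma c * Gamma d)) * (Gamma c * Gamma d / (Gamma a * Gamma b))"
    using g by (intro tendsto_intros) auto
  have one: "(Gamma a * Gamma b / (Gamma c * Gamma d)) * (Gamma c * Gamma d / (Gamma a * Gamma b)) = 1"
    using g by simp
  show ?thesis
    unfolding ratio by (rule lim[unfolded one])
qed

lemma widom_sq_LIMSEQ:
  assumes "s \<ge> 0"
  shows "(\<lambda>n. widom_sq n s) \<longlonglongrightarrow> 2"
proof (cases "s = 0")
  case True
  \<comment> \<open>The Chebyshev case: the Gamma factors cancel in pairs. The index starts at 1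
    because \<open>Gamma 0\<close> would occur at n = 0.\<close>
  have "widom_sq (Suc n) s = 2" for n
  proof -
    have "Gamma (2 * real (Suc n)) > 0" "Gamma (2 * real (Suc n) + 1) > 0"
      by (intro Gamma_real_pos; simp)+
    then have "Gamma (2 * real (Suc n)) \<noteq> 0" "Gamma (2 * real (Suc n) + 1) \<noteq> 0"
      by linarith+
    then show ?thesis
      by (simp add: widom_sq_def True del: of_nat_Suc)
  qed
  then have "(\<lambda>n. widom_sq (Suc n) s) \<longlonglongrightarrow> 2" by simp
  then show ?thesis by (rule LIMSEQ_imp_Suc)
next
  case False
  with assms have s: "s > 0" by simp
  \<comment> \<open>Along N = 2n + 1 the shift N + 1 is 2 (n + 1), which is what
    \<open>widom_sq (Suc n) s\<close> contains.\<close>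
  have sub: "strict_mono (\<lambda>n::nat. 2 * n + 1)" by (intro strict_monoI) simp
  have "(\<lambda>n. 2 * (Gamma (1 + real ((2 * n + 1) + 1)) * Gamma (2 * s + real ((2 * n + 1) + 1))
      / (Gamma (s + real ((2 * n + 1) + 1)) * Gamma (s + 1 + real ((2 * n + 1) + 1))))) \<longlonglongrightarrow> 2 * 1"
    using s LIMSEQ_subseq_LIMSEQ[OF Gamma_ratio_LIMSEQ[of 1 "2 * s" s "s + 1"] sub]
    by (intro tendsto_mult_left) (simp add: o_def)
  moreover have "2 * (Gamma (1 + real ((2 * n + 1) + 1)) * Gamma (2 * s + real ((2 * n + 1) + 1))
      / (Gamma (s + real ((2 * n + 1) + 1)) * Gamma (s + 1 + real ((2 * n + 1) + 1)))) = widom_sq (Suc n) s" for n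
    unfolding widom_sq_def by (simp add: algebra_simps)
  ultimately have "(\<lambda>n. widom_sq (Suc n) s) \<longlonglongrightarrow> 2" by simp
  then show ?thesis by (rule LIMSEQ_imp_Suc)
qed

section \<open>Orthogonal polynomials on the star\<close>

definition poly_inner :: "complex measure \<Rightarrow> complex poly \<Rightarrow> complex poly \<Rightarrow> complex" where
  "poly_inner \<mu> p q = (LINT z|\<mu>. poly p z * cnj (poly q z))"

context
  fixes \<mu> :: "complex measure"
  assumes moments: "\<And>a b. integrable \<mu> (\<lambda>z. z ^ a * cnj z ^ b)"
begin

lemma integrable_poly_mult_cnj: "integrable \<mu> (\<lambda>z. poly p z * cnj (poly q z))"
proof -
  have "(\<lambda>z. poly p z * cnj (poly q z)) =
     (\<lambda>z. \<Sum>a\<le>degree p. \<Sum>b\<le>degree q. (coeff p a * cnj (coeff q b)) * (z ^ a * cnj z ^ b))"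
    by (simp add: poly_altdef sum_product mult_ac)
  then show ?thesis
    by (simp only:) (intro Bochner_Integration.integrable_sum integrable_mult_right moments)
qed

lemma poly_inner_add_left: "poly_inner \<mu> (p + r) q = poly_inner \<mu> p q + poly_inner \<mu> r q"
  unfolding poly_inner_def poly_add distrib_right
  by (intro Bochner_Integration.integral_add integrable_poly_mult_cnj)

lemma poly_inner_smult_left: "poly_inner \<mu> (smult c p) q = c * poly_inner \<mu> p q"
  unfolding poly_inner_def by (simp add: mult.assoc)

lemma poly_inner_cnj: "cnj (poly_inner \<mu> p q) = poly_inner \<mu> q p"
  unfolding poly_inner_def by (simp add: mult.commute flip: Bochner_Integration.integral_cnj)

lemma poly_inner_add_right: "poly_inner \<mu> p (q + r) = poly_inner \<mu> p q + poly_inner \<mu> p r"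
  by (metis complex_cnj_add poly_inner_add_left poly_inner_cnj)

lemma poly_inner_smult_right: "poly_inner \<mu> p (smult c q) = cnj c * poly_inner \<mu> p q"
  by (metis complex_cnj_mult poly_inner_smult_left poly_inner_cnj)

lemma poly_inner_0_right [simp]: "poly_inner \<mu> p 0 = 0"
  by (simp add: poly_inner_def)

lemma poly_inner_diff_right: "poly_inner \<mu> p (q - r) = poly_inner \<mu> p q - poly_inner \<mu> p r"
  using poly_inner_add_right[of p "q - r" r] by simp

lemma poly_inner_diff_left: "poly_inner \<mu> (p - r) q = poly_inner \<mu> p q - poly_inner \<mu> r q"
  using poly_inner_add_left[of "p - r" r q] by simp

lemma poly_inner_sum_left: "poly_inner \<mu> (\<Sum>i\<in>I. f i) q = (\<Sum>i\<in>I. poly_inner \<mu> (f i) q)"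
  by (induction I rule: infinite_finite_induct) (simp_all add: poly_inner_add_left, simp_all add: poly_inner_def)

text \<open>One step of division with remainder. The alternative 0 is there for constant q, whose
  degree cannot drop.\<close>

lemma degree_reduce_monic:
  fixes q r :: "complex poly"
  assumes "degree r = degree q" "lead_coeff r = 1" "q \<noteq> 0"
  shows "q - smult (lead_coeff q) r = 0 \<or> degree (q - smult (lead_coeff q) r) < degree q"
proof (cases "degree q = 0")
  case True
  then obtain a where q: "q = [:a:]" by (metis degree_eq_zeroE)
  from True assms(1) obtain b where r: "r = [:b:]" by (metis degree_eq_zeroE)
  show ?thesis using assms(2) by (simp add: q r)
next
  case False
  have "degree (q - smult (lead_coeff q) r) \<le> degree q"
    using assms(1) by (intro degree_diff_le) auto
  moreover have "coeff (q - smult (lead_coeff q) r) (degree q) = 0"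
    using assms by simp
  ultimately show ?thesis
    by (metis le_neq_implies_less leading_coeff_0_iff)
qed

text \<open>The P j with j < n span the polynomials of degree below n. A general monic family is
  allowed since the lemma is applied to the monomials and also to a rival orthogonal
  sequence.\<close>

lemma poly_inner_lower_degree:
  assumes P: "\<And>j. j < n \<Longrightarrow> degree (P j) = j \<and> lead_coeff (P j) = 1 \<and> poly_inner \<mu> p (P j) = 0"
    and "degree q < n"
  shows "poly_inner \<mu> p q = 0"
  using assms(2)
proof (induction "degree q" arbitrary: q rule: less_induct)
  case less
  show ?case
  proof (cases "q = 0")
    case False
    let ?r = "q - smult (lead_coeff q) (P (degree q))"
    note Pq = P[OF less.prems]
    have "?r = 0 \<or> degree ?r < degree q"
      using Pq False by (intro degree_reduce_monic) auto
    then have "poly_inner \<mu> p ?r = 0"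
      using less.hyps[of ?r] less.prems by auto
    then show ?thesis
      using Pq by (simp add: poly_inner_diff_right poly_inner_smult_right)
  qed simp
qed

text \<open>Uniqueness rests on \<open>nz\<close> instead of definiteness of the form, so no
  infinite support has to be exhibited. The difference D of two candidates of degree n has some
  degree d < n and is orthogonal to P d; but P d pairs with D to the conjugated leading coefficient
  of D times the nonzero square of P d.\<close>

lemma monic_orthogonal_poly_eqI:
  assumes P: "\<And>n. degree (P n) = n" "\<And>n. lead_coeff (P n) = 1"
    and orth: "\<And>n j. j < n \<Longrightarrow> poly_inner \<mu> (P n) (monom 1 j) = 0"
    and nz: "\<And>n. poly_inner \<mu> (P n) (P n) \<noteq> 0"
  shows "monic_orthogonal_poly \<mu> = P"
proof -
  have low: "poly_inner \<mu> (P n) q = 0" if "degree q < n" for n q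
    using that orth by (intro poly_inner_lower_degree[where P = "monom 1" and n = n]) (auto simp: degree_monom_eq)
  have "is_monic_orthogonal_seq \<mu> P"
    unfolding is_monic_orthogonal_seq_def poly_inner_def[symmetric]
  proof (intro conjI allI impI)
    show "poly_inner \<mu> (P n) (P k) = 0" if "n \<noteq> k" for n k
    proof (cases "k < n")
      case True
      then show ?thesis by (intro low) (simp add: P)
    next
      case False
      then have "poly_inner \<mu> (P k) (P n) = 0" using that by (intro low) (simp add: P)
      then show ?thesis by (metis complex_cnj_zero poly_inner_cnj)
    qed
  qed (rule P)+
  moreover have "Q = P" if "is_monic_orthogonal_seq \<mu> Q" for Q
  proof
    fix n
    have Q: "\<And>n. degree (Q n) = n" "\<And>n. lead_coeff (Q n) = 1" "\<And>n k. n \<noteq> k \<Longrightarrow> poly_inner \<mu> (Q n) (Q k) = 0"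
      using that unfolding is_monic_orthogonal_seq_def poly_inner_def by blast+
    have lowQ: "poly_inner \<mu> (Q n) q = 0" if "degree q < n" for q
      using that Q by (intro poly_inner_lower_degree[where P = Q and n = n]) auto
    let ?D = "Q n - P n"
    show "Q n = P n"
    proof (rule ccontr)
      assume "Q n \<noteq> P n"
      then have D0: "?D \<noteq> 0" by simp
      have "P n \<noteq> 0" "Q n \<noteq> 0" using P(2)[of n] Q(2)[of n] by auto
      then have "?D = 0 \<or> degree ?D < n"
        using degree_reduce_monic[of "P n" "Q n"] P[of n] Q[of n] by simp
      with D0 have deg: "degree ?D < n" by blast
      let ?d = "degree ?D"
      have "poly_inner \<mu> (Q n) (P ?d) = 0" using deg by (intro lowQ) (simp add: P)
      moreover have "poly_inner \<mu> (P n) (P ?d) = 0" using deg by (intro low) (simp add: P)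
      ultimately have "poly_inner \<mu> ?D (P ?d) = 0" by (simp add: poly_inner_diff_left)
      then have z: "poly_inner \<mu> (P ?d) ?D = 0" by (metis complex_cnj_zero poly_inner_cnj)
      let ?r = "?D - smult (lead_coeff ?D) (P ?d)"
      have "?r = 0 \<or> degree ?r < ?d"
        using D0 P by (intro degree_reduce_monic) auto
      then have "poly_inner \<mu> (P ?d) ?r = 0"
        using low by auto
      then have "cnj (lead_coeff ?D) * poly_inner \<mu> (P ?d) (P ?d) = 0"
        using z by (simp only: poly_inner_diff_right[of "P ?d" ?D] poly_inner_smult_right) simp
      then show False
        by (metis D0 nz complex_cnj_zero_iff leading_coeff_0_iff mult_eq_0_iff)
    qed
  qed
  ultimately show ?thesis
    unfolding monic_orthogonal_poly_def by (rule the_equality)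
qed

lemma L2_norm_poly_squared: "complex_of_real ((L2_norm_poly \<mu> p)\<^sup>2) = poly_inner \<mu> p p"
proof -
  have "(L2_norm_poly \<mu> p)\<^sup>2 = (LINT z|\<mu>. (cmod (poly p z))\<^sup>2)"
    unfolding L2_norm_poly_def by (intro real_sqrt_pow2) simp
  then show ?thesis
    unfolding poly_inner_def by (simp add: complex_norm_square flip: integral_complex_of_real of_real_power)
qed

end

text \<open>The measure is invariant under rotation by 2m-th roots of unity, so monomials from
  different residue classes modulo 2m are orthogonal. This forces the exponents to stay in the class
  of N.\<close>

definition star_poly :: "nat \<Rightarrow> nat \<Rightarrow> complex poly" where
  "star_poly m N = (let n = N div (2 * m); l = N mod (2 * m) in
     \<Sum>k\<le>n. monom (of_real (jacobi_coeff n (real l / real m) k)) (2 * m * k + l))"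

context
  fixes m :: nat
  assumes m: "m > 0"
begin

lemma star_poly_coeff:
  assumes "l < 2 * m"
  shows "coeff (star_poly m (2 * m * n + l)) i =
     (\<Sum>k\<le>n. if 2 * m * k + l = i then of_real (jacobi_coeff n (real l / real m) k) else 0)"
  using assms by (simp add: star_poly_def coeff_sum)

lemma star_poly_monic:
  "degree (star_poly m N) = N" "lead_coeff (star_poly m N) = 1"
proof -
  define n l where "n = N div (2 * m)" and "l = N mod (2 * m)"
  have l: "l < 2 * m" using m by (simp add: l_def)
  have N: "N = 2 * m * n + l" by (simp add: n_def l_def)
  have c: "coeff (star_poly m N) N = 1"
  proof -
    have "coeff (star_poly m N) N = (\<Sum>k\<le>n. if k = n then of_real (jacobi_coeff n (real l / real m) k) else 0)"
      unfolding N star_poly_coeff[OF l] using m by (intro sum.cong refl) auto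
    then show ?thesis by (simp add: jacobi_coeff_leading)
  qed
  have "degree (star_poly m N) \<le> N"
  proof (rule degree_le, intro allI impI)
    fix i assume i: "N < i"
    have "2 * m * k + l \<noteq> i" if "k \<le> n" for k
    proof -
      have "2 * m * k \<le> 2 * m * n" using that by simp
      then show ?thesis using i N by linarith
    qed
    then show "coeff (star_poly m N) i = 0"
      unfolding N star_poly_coeff[OF l] by (intro sum.neutral) auto
  qed
  moreover have "N \<le> degree (star_poly m N)"
    using c by (intro le_degree) simp
  ultimately show "degree (star_poly m N) = N" by simp
  then show "lead_coeff (star_poly m N) = 1" using c by simp
qed

text \<open>Within one residue class the moments are those of the Jacobi weight with s = l/m, and
  the quotient \<open>j div (2 * m)\<close> takes the place of the test exponent q.\<close>

lemma star_poly_inner_monom: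
  assumes l: "l < 2 * m"
  shows "poly_inner (star_measure m) (star_poly m (2 * m * n + l)) (monom 1 j) =
    (if j mod (2 * m) = l then of_real (\<Sum>k\<le>n. jacobi_coeff n (real l / real m) k
        * sin_moment (2 * real (k + j div (2 * m)) + 2 * (real l / real m))) else 0)"
proof -
  note mom = star_moment[OF m]
  have summand: "poly_inner (star_measure m) (monom c a) (monom 1 j) =
     (if a mod (2 * m) = j mod (2 * m) then c * of_real (sin_moment (real (a + j) / real m)) else 0)" for c a
    unfolding poly_inner_def using mom(2)[of a j] by (simp add: poly_monom mult.assoc)
  have e: "real (2 * m * k + l + j) / real m = 2 * real (k + j div (2 * m)) + 2 * (real l / real m)"
    if "j mod (2 * m) = l" for k
  proof -
    have "real j = real (2 * m * (j div (2 * m)) + j mod (2 * m))" by simp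
    then have j: "real j = 2 * real m * real (j div (2 * m)) + real l" unfolding that by simp
    show ?thesis unfolding of_nat_add j using m by (simp add: field_simps)
  qed
  have "star_poly m (2 * m * n + l) = (\<Sum>k\<le>n. monom (of_real (jacobi_coeff n (real l / real m) k)) (2 * m * k + l))"
    using l by (simp add: star_poly_def)
  then have "poly_inner (star_measure m) (star_poly m (2 * m * n + l)) (monom 1 j) =
     (\<Sum>k\<le>n. poly_inner (star_measure m) (monom (of_real (jacobi_coeff n (real l / real m) k)) (2 * m * k + l)) (monom 1 j))"
    by (simp only: poly_inner_sum_left[OF mom(1)])
  also have "\<dots> = (\<Sum>k\<le>n. if j mod (2 * m) = l then of_real (jacobi_coeff n (real l / real m) k
        * sin_moment (2 * real (k + j div (2 * m)) + 2 * (real l / real m))) else 0)"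
    unfolding summand using l e by (intro sum.cong refl) auto
  finally show ?thesis by simp
qed

lemma star_poly_orthogonal:
  assumes "j < N"
  shows "poly_inner (star_measure m) (star_poly m N) (monom 1 j) = 0"
proof -
  define n l where "n = N div (2 * m)" and "l = N mod (2 * m)"
  have l: "l < 2 * m" using m by (simp add: l_def)
  have N: "N = 2 * m * n + l" by (simp add: n_def l_def)
  show ?thesis
  proof (cases "j mod (2 * m) = l")
    case True
    have j: "j = 2 * m * (j div (2 * m)) + l" using True by (metis mult_div_mod_eq)
    have q: "j div (2 * m) < n"
    proof (rule ccontr)
      assume "\<not> j div (2 * m) < n"
      then have "2 * m * n \<le> 2 * m * (j div (2 * m))" by simp
      with j N assms show False by linarith
    qed
    have "(\<Sum>k\<le>n. jacobi_coeff n (real l / real m) k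
        * sin_moment (2 * real (k + j div (2 * m)) + 2 * (real l / real m))) = 0"
      using q by (intro jacobi_orthogonal) (auto intro!: add_pos_nonneg)
    then show ?thesis
      unfolding N star_poly_inner_monom[OF l] by (simp only: of_real_0 if_cancel)
  qed (simp add: N star_poly_inner_monom[OF l])
qed

text \<open>A monic polynomial orthogonal to all lower degrees has the same pairing with itself as
  with z^N, and the latter is the sum evaluated in \<open>jacobi_norm\<close>. For N = 0, where n =
  s = 0, the value is the total mass instead.\<close>

lemma star_poly_norm:
  "poly_inner (star_measure m) (star_poly m N) (star_poly m N) =
     (if N = 0 then 1 else of_real (widom_sq (N div (2 * m)) (real (N mod (2 * m)) / real m)))"
proof -
  note mom = star_moment[OF m]
  define n l where "n = N div (2 * m)" and "l = N mod (2 * m)"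
  have l: "l < 2 * m" using m by (simp add: l_def)
  have N: "N = 2 * m * n + l" by (simp add: n_def l_def)
  have "poly_inner (star_measure m) (star_poly m N) (star_poly m N - smult 1 (monom 1 N)) = 0"
  proof -
    have "star_poly m N - smult (lead_coeff (star_poly m N)) (monom 1 N) = 0 \<or>
        degree (star_poly m N - smult (lead_coeff (star_poly m N)) (monom 1 N)) < degree (star_poly m N)"
      using star_poly_monic[of N] by (intro degree_reduce_monic) (auto simp: degree_monom_eq)
    then have "star_poly m N - smult 1 (monom 1 N) = 0 \<or> degree (star_poly m N - smult 1 (monom 1 N)) < N"
      unfolding star_poly_monic(2) unfolding star_poly_monic(1) .
    then show ?thesis
    proof
      assume "degree (star_poly m N - smult 1 (monom 1 N)) < N"
      then show ?thesis
        using star_poly_orthogonal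
        by (intro poly_inner_lower_degree[OF mom(1), where P = "monom 1" and n = N]) (auto simp: degree_monom_eq)
    qed (simp only: poly_inner_0_right[OF mom(1)])
  qed
  then have eq: "poly_inner (star_measure m) (star_poly m N) (star_poly m N)
      = poly_inner (star_measure m) (star_poly m N) (monom 1 N)"
    by (simp add: poly_inner_diff_right[OF mom(1)])
  show ?thesis
  proof (cases "N = 0")
    case True
    have "prob_space (star_measure m)" by (rule prob_space_star_measure[OF m])
    then have "measure (star_measure m) (space (star_measure m)) = 1" by (rule prob_space.prob_space)
    then show ?thesis
      unfolding eq by (simp add: True poly_inner_def star_poly_def jacobi_coeff_def)
  next
    case False
    have pos: "real n + real l / real m > 0"
      using False m N by (cases "n = 0") (auto intro!: add_pos_nonneg)
    have "poly_inner (star_measure m) (star_poly m N) (monom 1 N) = of_real (widom_sq n (real l / real m))"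
      using star_poly_inner_monom[OF l, of n N] jacobi_norm[OF _ pos]
      by (simp only: N[symmetric] n_def[symmetric] l_def[symmetric] if_True) simp
    then show ?thesis
      unfolding eq using False by (simp only: n_def l_def if_False)
  qed
qed

lemma monic_orthogonal_poly_star: "monic_orthogonal_poly (star_measure m) = star_poly m"
proof (rule monic_orthogonal_poly_eqI[OF star_moment(1)[OF m] star_poly_monic])
  show "poly_inner (star_measure m) (star_poly m N) (star_poly m N) \<noteq> 0" for N
  proof (cases "N = 0")
    case False
    have "real (N div (2 * m)) + real (N mod (2 * m)) / real m > 0"
    proof (cases "N div (2 * m) = 0")
      case True
      then show ?thesis using False m by (auto simp: div_eq_0_iff)
    qed (simp add: add_pos_nonneg)
    then have "widom_sq (N div (2 * m)) (real (N mod (2 * m)) / real m) > 0"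
      by (intro widom_sq_pos) auto
    then show ?thesis using False by (simp add: star_poly_norm)
  qed (simp add: star_poly_norm)
qed (rule star_poly_orthogonal)

lemma widom_factor_star:
  assumes "N > 0"
  shows "(widom_factor_L2 N (star_set m))\<^sup>2 = widom_sq (N div (2 * m)) (real (N mod (2 * m)) / real m)"
proof -
  have "complex_of_real ((widom_factor_L2 N (star_set m))\<^sup>2)
     = poly_inner (star_measure m) (star_poly m N) (star_poly m N)"
    unfolding widom_factor_L2_def equilibrium_measure_star_set[OF m] log_capacity_star_set[OF m]
      monic_orthogonal_poly_star power_one div_by_1
    by (rule L2_norm_poly_squared[OF star_moment(1)[OF m]])
  also have "\<dots> = of_real (widom_sq (N div (2 * m)) (real (N mod (2 * m)) / real m))"
    using assms by (simp add: star_poly_norm)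
  finally show ?thesis by (simp only: of_real_eq_iff)
qed

end

section \<open>Assembling the residue classes modulo 2m\<close>

lemma LIMSEQ_residue_classes:
  fixes f :: "nat \<Rightarrow> real"
  assumes q: "q > 0" and lim: "\<And>l. l < q \<Longrightarrow> (\<lambda>n. f (q * n + l)) \<longlonglongrightarrow> L"
  shows "f \<longlonglongrightarrow> L"
proof (rule LIMSEQ_I)
  fix e :: real assume "e > 0"
  then have "\<forall>l\<in>{..<q}. eventually (\<lambda>n. norm (f (q * n + l) - L) < e) sequentially"
    using lim by (auto simp: tendsto_iff dist_norm)
  then have "eventually (\<lambda>n. \<forall>l\<in>{..<q}. norm (f (q * n + l) - L) < e) sequentially"
    by (intro eventually_ball_finite) auto
  then obtain n0 where n0: "\<And>n l. n \<ge> n0 \<Longrightarrow> l < q \<Longrightarrow> norm (f (q * n + l) - L) < e"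
    by (auto simp: eventually_sequentially)
  have "norm (f N - L) < e" if "N \<ge> q * n0" for N
  proof -
    have "N div q \<ge> n0" using that q by (simp add: less_eq_div_iff_mult_less_eq mult.commute)
    then have "norm (f (q * (N div q) + N mod q) - L) < e" using q by (intro n0) auto
    then show ?thesis by simp
  qed
  then show "\<exists>no. \<forall>n\<ge>no. norm (f n - L) < e" by blast
qed

theorem theorem4:
  fixes m :: nat
  assumes "m > 0"
  shows "(\<lambda>n. (widom_factor_L2 n (star_set m))\<^sup>2) \<longlonglongrightarrow> 2 \<and>
    (\<forall>l::int.
      (0 < real_of_int l / real m \<and> real_of_int l / real m < 1 \<longrightarrow>
        incseq (\<lambda>n. (widom_factor_L2 (nat (2 * int n * int m + l)) (star_set m))\<^sup>2)) \<and>
      (1 < real_of_int l / real m \<and> real_of_int l / real m < 2 \<longrightarrow>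
        decseq (\<lambda>n. (widom_factor_L2 (nat (2 * int n * int m + l)) (star_set m))\<^sup>2)))"
proof (intro conjI allI impI)
  show "(\<lambda>n. (widom_factor_L2 n (star_set m))\<^sup>2) \<longlonglongrightarrow> 2"
  proof (rule LIMSEQ_residue_classes[of "2 * m"])
    fix l assume l: "l < 2 * m"
    \<comment> \<open>Starting at \<open>Suc n\<close> keeps the degree positive, also for l = 0,
      and does not affect the limit.\<close>
    have "(widom_factor_L2 (2 * m * Suc n + l) (star_set m))\<^sup>2 = widom_sq (Suc n) (real l / real m)" for n
    proof -
      have "2 * m * Suc n + l > 0" using assms by simp
      moreover have "(2 * m * Suc n + l) div (2 * m) = Suc n" "(2 * m * Suc n + l) mod (2 * m) = l"
        using l assms by (auto simp del: mult_Suc_right)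
      ultimately show ?thesis using widom_factor_star[OF assms, of "2 * m * Suc n + l"] by simp
    qed
    moreover have "(\<lambda>n. widom_sq (Suc n) (real l / real m)) \<longlonglongrightarrow> 2"
      by (intro LIMSEQ_Suc widom_sq_LIMSEQ) simp
    ultimately have "(\<lambda>n. (widom_factor_L2 (2 * m * Suc n + l) (star_set m))\<^sup>2) \<longlonglongrightarrow> 2"
      by (simp only:)
    then show "(\<lambda>n. (widom_factor_L2 (2 * m * n + l) (star_set m))\<^sup>2) \<longlonglongrightarrow> 2"
      by (rule LIMSEQ_imp_Suc)
  qed (use assms in simp)
next
  fix l :: int
  \<comment> \<open>The bounds make l a nonzero residue modulo 2m, so \<open>nat\<close> loses
    nothing, the degree is positive even for n = 0, and division by 2m returns n and l.\<close>
  have eq: "(widom_factor_L2 (nat (2 * int n * int m + l)) (star_set m))\<^sup>2 = widom_sq n (real_of_int l / real m)"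
    if "0 < real_of_int l / real m" "real_of_int l / real m < 2" for n
  proof -
    have "0 < real_of_int l" "real_of_int l < real_of_int (2 * int m)"
      using that assms by (auto simp: field_simps zero_less_divide_iff)
    then have l: "0 < l" "l < 2 * int m" by linarith+
    define k where "k = nat l"
    have k: "l = int k" "0 < k" "k < 2 * m" using l by (auto simp: k_def)
    have "nat (2 * int n * int m + l) = 2 * m * n + k"
      by (simp add: k nat_add_distrib nat_mult_distrib flip: of_nat_mult of_nat_add)
    moreover have "(2 * m * n + k) div (2 * m) = n" "(2 * m * n + k) mod (2 * m) = k"
      using k by auto
    ultimately show ?thesis
      using widom_factor_star[OF assms, of "2 * m * n + k"] k by simp
  qed
  show "incseq (\<lambda>n. (widom_factor_L2 (nat (2 * int n * int m + l)) (star_set m))\<^sup>2)"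
    if "0 < real_of_int l / real m \<and> real_of_int l / real m < 1"
    using that incseq_widom_sq by (subst eq) auto
  show "decseq (\<lambda>n. (widom_factor_L2 (nat (2 * int n * int m + l)) (star_set m))\<^sup>2)"
    if "1 < real_of_int l / real m \<and> real_of_int l / real m < 2"
    using that decseq_widom_sq by (subst eq) auto
qed

end
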